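(* Assume (Increments), (Waiting times) and (Integrability) as described in the context. For $\gamma<0$ let $\bar\lambda^\gamma$ be the constant of a solution $(\bar v^\gamma,\bar\lambda^\gamma)\in\mathcal{C}_b(\mathcal{S})\times\mathbb{R}$ of the Bellman equation $(B_\gamma)$ of the context, and let $\bar\lambda^0:=\lim_{\gamma\uparrow0}\bar\lambda^\gamma$. Then, for any $\pi\in\mathcal{S}$, $$\sup_{\mathbf\Pi\in\mathcal{A}(\pi)}J^0(\mathbf\Pi,\pi)=\bar\lambda^0=\lim_{\gamma\uparrow0}\bar\lambda^\gamma=\lim_{\gamma\uparrow0}\ \sup_{\mathbf\Pi\in\mathcal{A}(\pi)}J^\gamma(\mathbf\Pi,\pi).$$
   Context: Notation. $d\ge1$; $\langle x,y\rangle$ is the scalar product, $x\cdot y$ the component-wise product on $\mathbb{R}^d$; $\mathbf{1}=(1,\dots,1)$. $\mathcal{S}=\{\pi\in\mathbb{R}^d:\pi_i\ge0,\ \langle\pi,\mathbf{1}\rangle=1\}$; $\mathcal{C}_b(\mathcal{S})$ is the space of bounded continuous real functions on $\mathcal{S}$. $G(x,y):=\frac{x\cdot y}{\langle x,y\rangle}$. Transaction costs. $c_i,h_i\in[0,1)$, $i=1,\dots,d$; $p(x):=\sum_{i=1}^d\max(c_ix_i,-h_ix_i)$. For $\pi,\pi'\in\mathcal{S}$, $s(\pi,\pi')$ denotes the unique $w>0$ with $w+p(w\pi'-\pi)=1$ (ratio of wealth after to wealth before rebalancing from $\pi$ to $\pi'$ in a self-financing way). Market. $S(t)=(S_1(t),\dots,S_d(t))$,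 $t\ge0$, is a process of strictly positive prices, $R(t_1,t_2)=(S_i(t_2)/S_i(t_1))_{i}$, $R(t)=R(0,t)$, $r(t)=\ln R(t)$ (component-wise). $(\eta_i)_{i\ge1}$ are i.i.d. $(0,\infty)$-valued random variables, independent of the price process; $\tau_0=0$, $\tau_{n+1}=\tau_n+\eta_{n+1}$. (Increments): $t\mapsto\ln S(t)$ is right-continuous and has stationary independent increments. (Waiting times): $\mathbb{P}[\eta_i>0]=1$ and $\mathbb{E}[\eta_i]<\infty$. (Integrability): for any $\gamma<0$, $\mathbb{E}[e^{\gamma\min_i r_i(\eta_1)}]<\infty$, and $\mathbb{E}[\max_i r_i(\eta_1)]<\infty$. Entropic utility. $\mu^\gamma[Z]:=\frac1\gamma\ln\mathbb{E}[e^{\gamma Z}]$ for $\gamma<0$ and $\mu^0[Z]:=\mathbb{E}[Z]$. Strategies. For $\pi\in\mathcal{S}$, $\mathcal{A}(\pi)$ is the set of $\mathcal{S}$-valued weight processes $\mathbf\Pi=(\pi(t))_{t\ge0}$ with $\pi(0-)=\pi$, rebalanced only at the times $\tau_n$: at $\tau_n$ new weights $\pi(\tau_n)\in\mathcal{S}$ are chosen non-anticipatively, $\pi(t)=G(\pi(\tau_n),R(\tau_n,t))$ for $t\in[\tau_n,\tau_{n+1})$, and the pre-rebalancing weights are $\pi(\tau_{n+1}^-)=G(\pi(\tau_n),R(\tau_n,\tau_{n+1}))$, $\pi(\tau_0^-)=\pi$. Non-anticipative means: $\pi(\tau_n)$ is measurable with respect to $\mathcal{G}_n$, where $(\mathcal{G}_n)_{n\ge0}$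 is a given increasing sequence of $\sigma$-fields (information at $\tau_n$) such that $\eta_1,\dots,\eta_n$ and the price path stopped at $\tau_n$ are $\mathcal{G}_n$-measurable and $((\eta_k)_{k>n},(R(\tau_n,\tau_n+t))_{t\ge0})$ is independent of $\mathcal{G}_n$. Functional. For $\gamma\le0$, $$J^\gamma(\mathbf\Pi,\pi)=\liminf_{n\to\infty}\frac1{\mathbb{E}[\tau_n]}\mu^\gamma\Big[\sum_{i=0}^{n-1}\big(\ln s(\pi(\tau_i^-),\pi(\tau_i))+\ln\langle\pi(\tau_i),R(\tau_i,\tau_{i+1})\rangle\big)\Big].$$ Bellman equation $(B_\gamma)$, $\gamma\le 0$: $$\bar v^\gamma(\pi)=\sup_{\pi'\in\mathcal{S}}\Big(\ln s(\pi,\pi')-\bar\lambda^\gamma\,\mathbb{E}[\eta_1]+\mu^\gamma\big[\ln\langle \pi',R(\eta_1)\rangle+\bar v^\gamma(G(\pi',R(\eta_1)))\big]\Big),\qquad \pi\in\mathcal{S}.$$ Under the three conditions a solution of $(B_\gamma)$ in $\mathcal{C}_b(\mathcal{S})\times\mathbb{R}$ exists for each $\gamma<0$; the constant $\bar\lambda^\gamma$ does not depend on the choice of the solution and is non-decreasing in $\gamma$, so $\bar\lambda^0$ is well defined. *)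

theory Defs
  imports "HOL-Probability.Probability"
begin

unbundle inner_syntax

section \<open>Weights and transaction costs\<close>

definition weight_simplex :: "(real^'d::finite) set" where
  "weight_simplex = {\<pi>. (\<forall>i. 0 \<le> \<pi> $ i) \<and> \<pi> \<bullet> 1 = 1}"

definition drift :: "real^'d::finite \<Rightarrow> real^'d \<Rightarrow> real^'d" where
  "drift x y = (1 / (x \<bullet> y)) *\<^sub>R (x * y)"

text \<open>The vectors \<open>c\<close> and \<open>h\<close> hold the proportional rates for purchases and sales.\<close>

definition cost_rates :: "real^'d::finite \<Rightarrow> real^'d \<Rightarrow> bool" where
  "cost_rates c h \<longleftrightarrow> (\<forall>i. c $ i \<in> {0..<1} \<and> h $ i \<in> {0..<1})"

definition cost :: "real^'d::finite \<Rightarrow> real^'d \<Rightarrow> real^'d \<Rightarrow> real" where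
  "cost c h x = (\<Sum>i\<in>UNIV. max (c $ i * x $ i) (- h $ i * x $ i))"

text \<open>For \<open>cost_rates c h\<close> and weights in the simplex the solution \<open>w\<close> exists and is unique.\<close>

definition wealth_ratio ::
  "real^'d::finite \<Rightarrow> real^'d \<Rightarrow> real^'d \<Rightarrow> real^'d \<Rightarrow> real" where
  "wealth_ratio c h \<pi> \<pi>' = (THE w. 0 < w \<and> w + cost c h (w *\<^sub>R \<pi>' - \<pi>) = 1)"


section \<open>Market\<close>

text \<open>A process is a function of time and scenario; only times \<open>t \<ge> 0\<close> matter for prices.\<close>

definition price_process :: "'a measure \<Rightarrow> (real \<Rightarrow> 'a \<Rightarrow> real^'d::finite) \<Rightarrow> bool" where
  "price_process M S \<longleftrightarrow>
     (\<forall>t\<ge>0. S t \<in> borel_measurable M \<and> (\<forall>\<omega>\<in>space M. \<forall>i. 0 < S t \<omega> $ i))"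

definition log_price :: "(real \<Rightarrow> 'a \<Rightarrow> real^'d::finite) \<Rightarrow> real \<Rightarrow> 'a \<Rightarrow> real^'d" where
  "log_price S t \<omega> = (\<chi> i. ln (S t \<omega> $ i))"

definition price_ratio ::
  "(real \<Rightarrow> 'a \<Rightarrow> real^'d::finite) \<Rightarrow> real \<Rightarrow> real \<Rightarrow> 'a \<Rightarrow> real^'d" where
  "price_ratio S t1 t2 \<omega> = (\<chi> i. S t2 \<omega> $ i / S t1 \<omega> $ i)"

definition log_return :: "(real \<Rightarrow> 'a \<Rightarrow> real^'d::finite) \<Rightarrow> real \<Rightarrow> 'a \<Rightarrow> real^'d" where
  "log_return S t \<omega> = (\<chi> i. ln (price_ratio S 0 t \<omega> $ i))"

definition increments_cond :: "'a measure \<Rightarrow> (real \<Rightarrow> 'a \<Rightarrow> real^'d::finite) \<Rightarrow> bool" where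
  "increments_cond M S \<longleftrightarrow>
     (\<forall>\<omega>\<in>space M. \<forall>t\<ge>0. continuous (at_right t) (\<lambda>u. log_price S u \<omega>)) \<and>
     (\<forall>t\<ge>0. \<forall>u\<ge>0. distr M borel (\<lambda>\<omega>. log_price S (t + u) \<omega> - log_price S t \<omega>) =
        distr M borel (\<lambda>\<omega>. log_price S u \<omega> - log_price S 0 \<omega>)) \<and>
     (\<forall>(n::nat) t. 0 \<le> t 0 \<and> (\<forall>i<n. t i < t (Suc i)) \<longrightarrow>
        prob_space.indep_vars M (\<lambda>_. borel)
          (\<lambda>i \<omega>. log_price S (t (Suc i)) \<omega> - log_price S (t i) \<omega>) {..<n})"

text \<open>The sigma-field on \<open>space M\<close> generated by the family \<open>(X i)\<close>, \<open>i \<in> I\<close>.\<close>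

definition sigma_of :: "'a measure \<Rightarrow> 'i set \<Rightarrow> ('i \<Rightarrow> 'a \<Rightarrow> 'b::topological_space) \<Rightarrow> 'a measure"
  where "sigma_of M I X =
    vimage_algebra (space M) (\<lambda>\<omega>. \<lambda>i\<in>I. X i \<omega>) (\<Pi>\<^sub>M i\<in>I. borel)"

text \<open>The waiting times are \<open>\<eta> 1, \<eta> 2, \<dots>\<close>; the value \<open>\<eta> 0\<close> is never used.\<close>

definition waiting_process ::
  "'a measure \<Rightarrow> (real \<Rightarrow> 'a \<Rightarrow> real^'d::finite) \<Rightarrow> (nat \<Rightarrow> 'a \<Rightarrow> real) \<Rightarrow> bool" where
  "waiting_process M S \<eta> \<longleftrightarrow>
     prob_space.indep_vars M (\<lambda>_. borel) \<eta> {1..} \<and>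
     (\<forall>i\<ge>1. distr M borel (\<eta> i) = distr M borel (\<eta> 1)) \<and>
     (\<forall>i\<ge>1. \<forall>\<omega>\<in>space M. 0 < \<eta> i \<omega>) \<and>
     prob_space.indep_set M (sets (sigma_of M {1..} \<eta>)) (sets (sigma_of M {0..} S))"

definition waiting_times_cond :: "'a measure \<Rightarrow> (nat \<Rightarrow> 'a \<Rightarrow> real) \<Rightarrow> bool" where
  "waiting_times_cond M \<eta> \<longleftrightarrow> (\<forall>i\<ge>1. (AE \<omega> in M. 0 < \<eta> i \<omega>) \<and> integrable M (\<eta> i))"

text \<open>The first condition makes the negative part of the maximum integrable, so that
  integrability in the second one says exactly that the expectation is not \<open>\<infinity>\<close>.\<close>

definition integrability_cond ::
  "'a measure \<Rightarrow> (real \<Rightarrow> 'a \<Rightarrow> real^'d::finite) \<Rightarrow> (nat \<Rightarrow> 'a \<Rightarrow> real) \<Rightarrow> bool" where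
  "integrability_cond M S \<eta> \<longleftrightarrow>
     (\<forall>\<gamma><0. integrable M (\<lambda>\<omega>. exp (\<gamma> * (MIN i. log_return S (\<eta> 1 \<omega>) \<omega> $ i)))) \<and>
     integrable M (\<lambda>\<omega>. MAX i. log_return S (\<eta> 1 \<omega>) \<omega> $ i)"

definition jump_time :: "(nat \<Rightarrow> 'a \<Rightarrow> real) \<Rightarrow> nat \<Rightarrow> 'a \<Rightarrow> real" where
  "jump_time \<eta> n \<omega> = (\<Sum>k=1..n. \<eta> k \<omega>)"

text \<open>\<open>\<G> n\<close> is the information available at the \<open>n\<close>-th rebalancing time. In the last clause the
  future waiting times and the future relative price path are independent of \<open>\<G> n\<close> jointly.\<close>

definition information ::
  "'a measure \<Rightarrow> (real \<Rightarrow> 'a \<Rightarrow> real^'d::finite) \<Rightarrow> (nat \<Rightarrow> 'a \<Rightarrow> real) \<Rightarrow> (nat \<Rightarrow> 'a measure) \<Rightarrow> bool"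
  where
  "information M S \<eta> \<G> \<longleftrightarrow>
     (\<forall>n. subalgebra M (\<G> n) \<and> subalgebra (\<G> (Suc n)) (\<G> n) \<and>
        (\<forall>k\<in>{1..n}. \<eta> k \<in> borel_measurable (\<G> n)) \<and>
        (\<forall>t\<ge>0. (\<lambda>\<omega>. S (min t (jump_time \<eta> n \<omega>)) \<omega>) \<in> borel_measurable (\<G> n)) \<and>
        prob_space.indep_set M (sets (\<G> n))
          (sets (vimage_algebra (space M)
             (\<lambda>\<omega>. (\<lambda>k\<in>{n<..}. \<eta> k \<omega>,
                  \<lambda>t\<in>{0..}. price_ratio S (jump_time \<eta> n \<omega>) (jump_time \<eta> n \<omega> + t) \<omega>))
             ((\<Pi>\<^sub>M k\<in>{n<..}. borel) \<Otimes>\<^sub>M (\<Pi>\<^sub>M t\<in>{0..}. borel)))))"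


section \<open>Strategies and functionals\<close>

text \<open>In all uses below \<open>exp (\<gamma> * Z)\<close> (respectively \<open>Z\<close>) is integrable under the integrability
  condition, so the real-valued integral is the genuine expectation.\<close>

definition entropic_utility :: "'a measure \<Rightarrow> real \<Rightarrow> ('a \<Rightarrow> real) \<Rightarrow> real" where
  "entropic_utility M \<gamma> Z =
     (if \<gamma> = 0 then (\<integral>\<omega>. Z \<omega> \<partial>M) else (1 / \<gamma>) * ln (\<integral>\<omega>. exp (\<gamma> * Z \<omega>) \<partial>M))"

text \<open>Weight processes are extended by their initial weight to negative times; this encodes
  the prescribed value at \<open>0-\<close>. Beyond an accumulation point of the rebalancing times (a null
  event) they are only required to take values in the simplex.\<close>

definition strategies ::
  "'a measure \<Rightarrow> (real \<Rightarrow> 'a \<Rightarrow> real^'d::finite) \<Rightarrow> (nat \<Rightarrow> 'a \<Rightarrow> real) \<Rightarrow> (nat \<Rightarrow> 'a measure) \<Rightarrow>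
    real^'d \<Rightarrow> (real \<Rightarrow> 'a \<Rightarrow> real^'d) set" where
  "strategies M S \<eta> \<G> \<pi> = {W.
     (\<forall>\<omega>\<in>space M. \<forall>t<0. W t \<omega> = \<pi>) \<and>
     (\<forall>\<omega>\<in>space M. \<forall>t\<ge>0. W t \<omega> \<in> weight_simplex) \<and>
     (\<forall>n. (\<lambda>\<omega>. W (jump_time \<eta> n \<omega>) \<omega>) \<in> borel_measurable (\<G> n)) \<and>
     (\<forall>\<omega>\<in>space M. \<forall>n. \<forall>t\<in>{jump_time \<eta> n \<omega>..<jump_time \<eta> (Suc n) \<omega>}.
        W t \<omega> = drift (W (jump_time \<eta> n \<omega>) \<omega>) (price_ratio S (jump_time \<eta> n \<omega>) t \<omega>))}"

text \<open>The weight just before the \<open>n\<close>-th rebalancing. For \<open>n > 0\<close> it includes a price jump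
  at the rebalancing time itself, so it need not be the left limit of \<open>W\<close>.\<close>

primrec pre_weight ::
  "(real \<Rightarrow> 'a \<Rightarrow> real^'d::finite) \<Rightarrow> (nat \<Rightarrow> 'a \<Rightarrow> real) \<Rightarrow> (real \<Rightarrow> 'a \<Rightarrow> real^'d) \<Rightarrow>
    real^'d \<Rightarrow> nat \<Rightarrow> 'a \<Rightarrow> real^'d" where
  "pre_weight S \<eta> W \<pi> 0 \<omega> = \<pi>"
| "pre_weight S \<eta> W \<pi> (Suc n) \<omega> =
     drift (W (jump_time \<eta> n \<omega>) \<omega>)
       (price_ratio S (jump_time \<eta> n \<omega>) (jump_time \<eta> (Suc n) \<omega>) \<omega>)"

definition log_wealth ::
  "(real \<Rightarrow> 'a \<Rightarrow> real^'d::finite) \<Rightarrow> (nat \<Rightarrow> 'a \<Rightarrow> real) \<Rightarrow> real^'d \<Rightarrow> real^'d \<Rightarrow>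
    (real \<Rightarrow> 'a \<Rightarrow> real^'d) \<Rightarrow> real^'d \<Rightarrow> nat \<Rightarrow> 'a \<Rightarrow> real" where
  "log_wealth S \<eta> c h W \<pi> n \<omega> =
     (\<Sum>i<n. ln (wealth_ratio c h (pre_weight S \<eta> W \<pi> i \<omega>) (W (jump_time \<eta> i \<omega>) \<omega>)) +
        ln (W (jump_time \<eta> i \<omega>) \<omega> \<bullet>
          price_ratio S (jump_time \<eta> i \<omega>) (jump_time \<eta> (Suc i) \<omega>) \<omega>))"

definition growth_functional ::
  "'a measure \<Rightarrow> (real \<Rightarrow> 'a \<Rightarrow> real^'d::finite) \<Rightarrow> (nat \<Rightarrow> 'a \<Rightarrow> real) \<Rightarrow> real^'d \<Rightarrow> real^'d \<Rightarrow>
    real \<Rightarrow> (real \<Rightarrow> 'a \<Rightarrow> real^'d) \<Rightarrow> real^'d \<Rightarrow> ereal" where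
  "growth_functional M S \<eta> c h \<gamma> W \<pi> =
     liminf (\<lambda>n. ereal (1 / (\<integral>\<omega>. jump_time \<eta> n \<omega> \<partial>M) *
       entropic_utility M \<gamma> (log_wealth S \<eta> c h W \<pi> n)))"

definition bellman_solution ::
  "'a measure \<Rightarrow> (real \<Rightarrow> 'a \<Rightarrow> real^'d::finite) \<Rightarrow> (nat \<Rightarrow> 'a \<Rightarrow> real) \<Rightarrow> real^'d \<Rightarrow> real^'d \<Rightarrow>
    real \<Rightarrow> (real^'d \<Rightarrow> real) \<Rightarrow> real \<Rightarrow> bool" where
  "bellman_solution M S \<eta> c h \<gamma> v lam \<longleftrightarrow>
     continuous_on weight_simplex v \<and> bounded (v ` weight_simplex) \<and>
     (\<forall>\<pi>\<in>weight_simplex. ereal (v \<pi>) =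
       (SUP \<pi>'\<in>weight_simplex. ereal (ln (wealth_ratio c h \<pi> \<pi>') - lam * (\<integral>\<omega>. \<eta> 1 \<omega> \<partial>M) +
          entropic_utility M \<gamma> (\<lambda>\<omega>. ln (\<pi>' \<bullet> price_ratio S 0 (\<eta> 1 \<omega>) \<omega>) +
            v (drift \<pi>' (price_ratio S 0 (\<eta> 1 \<omega>) \<omega>))))))"

end

theory Submission
  imports Defs
begin

text \<open>
  The risk-neutral value is reached from the risk-sensitive ones by comparing \<open>\<mu>\<^sup>\<gamma>\<close> with the expectation
  at a fixed number of periods, with an error independent of \<open>\<gamma>\<close>. Below, \<open>X n\<close> is the log-wealth after
  \<open>n\<close> periods.

  For \<open>\<gamma> < 0\<close> the returns over the periods between rebalancings are independent of the information at
  the start of the period and distributed like the first one (\<open>nn_integral_next_return\<close>). So a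
  conditional expectation of the exponential of log-wealth plus \<open>v\<^sup>\<gamma>\<close> of the weight can be taken one
  period at a time (\<open>exp_wealth_step\<close>), and the Bellman equation turns it into a multiplicative sub-
  or supermartingale: every strategy satisfies \<open>\<mu>\<^sup>\<gamma>[X n] \<le> n * lam \<gamma> * E[\<eta> 1] + K\<close>
  (\<open>entropic_wealth_uniform_bound\<close>), and a measurable feedback rule that nearly attains the supremum
  satisfies the reverse inequality with \<open>lam \<gamma> - \<epsilon>\<close> and \<open>- K\<close> (\<open>near_optimal_strategy\<close>). Hence \<open>lam \<gamma>\<close> is the
  optimal risk-sensitive growth rate (\<open>entropic_value\<close>).

  What makes the limit \<open>\<gamma> \<rightarrow> 0\<close> easy is that \<open>K\<close> does not depend on \<open>\<gamma>\<close>. The current weight enters the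
  Bellman equation only through the rebalancing cost \<open>ln s(\<pi>, \<pi>')\<close>, which is Lipschitz in \<open>\<pi>\<close>
  uniformly in \<open>\<pi>'\<close> (\<open>ln_wealth_ratio_lipschitz\<close>). Every solution \<open>v\<^sup>\<gamma>\<close> inherits this Lipschitz constant,
  and therefore its oscillation on the simplex is at most \<open>K\<close>.

  By Jensen's inequality \<open>J\<^sup>\<gamma> \<le> J\<^sup>0\<close>, so \<open>lam \<gamma> \<le> sup J\<^sup>0\<close>. Conversely, let \<open>a\<close> be less than \<open>J\<^sup>0\<close> of some
  strategy. Then \<open>E[X n] > n * a * E[\<eta> 1] + K\<close> for some \<open>n\<close>. With this \<open>n\<close> fixed, \<open>\<mu>\<^sup>\<gamma>[X n]\<close> is at least
  the difference quotient \<open>(E[exp (\<gamma> * X n)] - 1) / \<gamma>\<close>, which tends to \<open>E[X n]\<close>. So for \<open>\<gamma>\<close> close to \<open>0\<close> the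
  uniform bound gives \<open>lam \<gamma> > a\<close> (\<open>eventually_bellman_constant_greater\<close>). Thus \<open>lam \<gamma>\<close> converges to
  \<open>sup J\<^sup>0\<close> from every initial weight, and uniqueness of limits makes that supremum independent of
  the initial weight.
\<close>

section \<open>The simplex and the cost of rebalancing\<close>

lemma weight_simplex_iff:
  "\<pi> \<in> weight_simplex \<longleftrightarrow> (\<forall>i. 0 \<le> \<pi> $ i) \<and> (\<Sum>i\<in>UNIV. \<pi> $ i) = 1"
  by (simp add: weight_simplex_def inner_vec_def)

lemma weight_simplex_norm_le_1:
  assumes "\<pi> \<in> weight_simplex"
  shows "norm \<pi> \<le> 1"
proof -
  have "norm \<pi> \<le> (\<Sum>i\<in>UNIV. \<bar>\<pi> $ i\<bar>)"
    by (rule norm_le_l1_cart)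
  also have "\<dots> = 1"
    using assms by (simp add: weight_simplex_iff)
  finally show ?thesis .
qed

lemma weight_simplex_dist_le_2:
  assumes "\<pi> \<in> weight_simplex" "\<pi>' \<in> weight_simplex"
  shows "dist \<pi> \<pi>' \<le> 2"
  using norm_triangle_ineq4[of \<pi> \<pi>'] assms[THEN weight_simplex_norm_le_1]
  by (simp add: dist_norm)

lemma l1_le_card_norm:
  fixes x :: "real^'d::finite"
  shows "(\<Sum>i\<in>UNIV. \<bar>x $ i\<bar>) \<le> real CARD('d) * norm x"
  using sum_bounded_above[of UNIV "\<lambda>i. \<bar>x $ i\<bar>" "norm x"]
  by (simp add: component_le_norm_cart)

lemma closed_weight_simplex: "closed (weight_simplex :: (real^'d::finite) set)"
proof -
  have "weight_simplex = (\<Inter>i. {\<pi> :: real^'d. 0 \<le> \<pi> $ i}) \<inter> {\<pi>. \<pi> \<bullet> 1 = 1}"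
    by (auto simp: weight_simplex_def)
  also have "closed \<dots>"
    by (intro closed_Int closed_INT ballI closed_Collect_le closed_Collect_eq continuous_intros)
  finally show ?thesis .
qed

lemma uniform_weight: "(\<chi> i. 1 / real CARD('d)) \<in> (weight_simplex :: (real^'d::finite) set)"
  by (simp add: weight_simplex_iff)

lemma inner_pos_simplex:
  assumes "\<pi> \<in> weight_simplex" "\<And>i. 0 < x $ i"
  shows "0 < \<pi> \<bullet> x"
proof -
  have "\<exists>i. \<pi> $ i \<noteq> 0"
  proof (rule ccontr)
    assume "\<nexists>i. \<pi> $ i \<noteq> 0"
    then show False using assms(1) by (simp add: weight_simplex_iff)
  qed
  then obtain i where "0 < \<pi> $ i"
    using assms(1) by (auto simp: weight_simplex_iff less_le)
  then show ?thesis
    unfolding inner_vec_def using assms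
    by (auto intro!: sum_pos2[of _ i] simp: weight_simplex_iff less_imp_le)
qed

lemma drift_in_simplex:
  assumes "\<pi> \<in> weight_simplex" "\<And>i. 0 < x $ i"
  shows "drift \<pi> x \<in> weight_simplex"
proof -
  have p: "0 < \<pi> \<bullet> x"
    using inner_pos_simplex[OF assms] .
  have "(\<Sum>i\<in>UNIV. drift \<pi> x $ i) = (\<Sum>i\<in>UNIV. \<pi> $ i * x $ i) / (\<pi> \<bullet> x)"
    by (simp add: drift_def sum_divide_distrib)
  also have "\<dots> = 1"
    using p by (simp add: inner_vec_def)
  finally show ?thesis
    using assms p by (simp add: weight_simplex_iff drift_def less_imp_le)
qed

lemma drift_one: "\<pi> \<in> weight_simplex \<Longrightarrow> drift \<pi> 1 = \<pi>"
  by (simp add: drift_def weight_simplex_def)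

text \<open>
  A portfolio return is a convex combination of the asset returns.
\<close>

lemma ln_inner_simplex_bounds:
  fixes x :: "real^'d::finite"
  assumes "\<pi> \<in> weight_simplex" "\<And>i. 0 < x $ i"
  shows "(MIN i. ln (x $ i)) \<le> ln (\<pi> \<bullet> x)" "ln (\<pi> \<bullet> x) \<le> (MAX i. ln (x $ i))"
proof -
  have p: "0 < \<pi> \<bullet> x"
    using inner_pos_simplex[OF assms] .
  have s: "(\<Sum>i\<in>UNIV. \<pi> $ i * a) = a" for a :: real
    using assms(1) by (simp add: weight_simplex_iff flip: sum_distrib_right)
  have "exp (MIN i. ln (x $ i)) \<le> x $ i" for i
    using assms(2)[of i] by (subst ln_ge_iff[symmetric]) auto
  then have "(\<Sum>i\<in>UNIV. \<pi> $ i * exp (MIN i. ln (x $ i))) \<le> \<pi> \<bullet> x"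
    unfolding inner_vec_def using assms(1)
    by (auto intro!: sum_mono mult_left_mono simp: weight_simplex_iff)
  then show "(MIN i. ln (x $ i)) \<le> ln (\<pi> \<bullet> x)"
    unfolding s using p by (simp add: ln_ge_iff)
  have "x $ i \<le> exp (MAX i. ln (x $ i))" for i
  proof -
    have "ln (x $ i) \<le> (MAX i. ln (x $ i))" by simp
    then show ?thesis using assms(2)[of i] by (metis exp_le_cancel_iff exp_ln)
  qed
  then have "\<pi> \<bullet> x \<le> (\<Sum>i\<in>UNIV. \<pi> $ i * exp (MAX i. ln (x $ i)))"
    unfolding inner_vec_def using assms(1)
    by (auto intro!: sum_mono mult_left_mono simp: weight_simplex_iff)
  then show "ln (\<pi> \<bullet> x) \<le> (MAX i. ln (x $ i))"
    unfolding s using p by (metis exp_gt_zero ln_exp ln_le_cancel_iff)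
qed

lemma cost_nonneg:
  assumes "cost_rates c h"
  shows "0 \<le> cost c h x"
  unfolding cost_def
proof (rule sum_nonneg)
  fix i
  have "0 \<le> c $ i" "0 \<le> h $ i"
    using assms by (auto simp: cost_rates_def)
  then show "0 \<le> max (c $ i * x $ i) (- h $ i * x $ i)"
    by (cases "0 \<le> x $ i") (auto simp: le_max_iff_disj mult_nonneg_nonneg mult_nonneg_nonpos)
qed

text \<open>
  All rates are less than \<open>1\<close>, and so is their maximum. That the constant is strictly below \<open>1\<close> makes
  the self-financing equation uniquely solvable.
\<close>

lemma cost_lipschitz:
  fixes c h :: "real^'d::finite"
  assumes "cost_rates c h"
  obtains \<kappa> where "0 \<le> \<kappa>" "\<kappa> < 1"
    "\<And>x y. \<bar>cost c h x - cost c h y\<bar> \<le> \<kappa> * (\<Sum>i\<in>UNIV. \<bar>x $ i - y $ i\<bar>)"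
proof
  define \<kappa> where "\<kappa> = (MAX i. max (c $ i) (h $ i))"
  have bd: "0 \<le> c $ i" "c $ i \<le> \<kappa>" "0 \<le> h $ i" "h $ i \<le> \<kappa>" for i
  proof -
    have "max (c $ i) (h $ i) \<le> \<kappa>" unfolding \<kappa>_def by (rule Max_ge) auto
    then show "0 \<le> c $ i" "c $ i \<le> \<kappa>" "0 \<le> h $ i" "h $ i \<le> \<kappa>"
      using assms by (auto simp: cost_rates_def)
  qed
  show "0 \<le> \<kappa>"
    using bd order_trans by blast
  have "\<kappa> \<in> range (\<lambda>i. max (c $ i) (h $ i))"
    unfolding \<kappa>_def by (rule Max_in) auto
  then show "\<kappa> < 1"
    using assms by (auto simp: cost_rates_def)
  have *: "\<bar>max (a * x) (- b * x) - max (a * y) (- b * y)\<bar> \<le> \<kappa> * \<bar>x - y\<bar>"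
    if "0 \<le> a" "a \<le> \<kappa>" "0 \<le> b" "b \<le> \<kappa>" for a b x y :: real
  proof -
    have "\<bar>max (a * x) (- b * x) - max (a * y) (- b * y)\<bar> \<le> max \<bar>a * x - a * y\<bar> \<bar>- b * x - (- b * y)\<bar>"
      by (auto simp: max_def abs_if)
    also have "\<dots> = max (a * \<bar>x - y\<bar>) (b * \<bar>x - y\<bar>)"
      using that by (simp add: abs_mult right_diff_distrib[symmetric] abs_minus_commute
          flip: minus_mult_right) 
    also have "\<dots> \<le> \<kappa> * \<bar>x - y\<bar>"
      using that by (auto intro!: mult_right_mono)
    finally show ?thesis .
  qed
  show "\<bar>cost c h x - cost c h y\<bar> \<le> \<kappa> * (\<Sum>i\<in>UNIV. \<bar>x $ i - y $ i\<bar>)" for x y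
    unfolding cost_def sum_subtractf[symmetric] sum_distrib_left
    by (rule order_trans[OF sum_abs], rule sum_mono, rule *) (simp_all add: bd)
qed

text \<open>
  As a function of \<open>w\<close> the cost is a contraction, so \<open>w\<close> plus the cost is strictly increasing;
  it is below \<open>1\<close> at \<open>w = 0\<close> and at least \<open>1\<close> at \<open>w = 1\<close>.
\<close>

lemma wealth_ratio_unique_root:
  fixes c h :: "real^'d::finite"
  assumes cr: "cost_rates c h" and \<pi>: "\<pi> \<in> weight_simplex" "\<pi>' \<in> weight_simplex"
  shows "\<exists>!w. 0 < w \<and> w + cost c h (w *\<^sub>R \<pi>' - \<pi>) = 1"
proof -
  obtain \<kappa> where \<kappa>: "0 \<le> \<kappa>" "\<kappa> < 1"
    "\<And>x y. \<bar>cost c h x - cost c h y\<bar> \<le> \<kappa> * (\<Sum>i\<in>UNIV. \<bar>x $ i - y $ i\<bar>)"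
    using cost_lipschitz[OF cr] by blast
  let ?g = "\<lambda>w. w + cost c h (w *\<^sub>R \<pi>' - \<pi>)"
  have lip: "\<bar>cost c h (w *\<^sub>R \<pi>' - \<pi>) - cost c h (w' *\<^sub>R \<pi>' - \<pi>)\<bar> \<le> \<kappa> * \<bar>w - w'\<bar>" for w w'
  proof -
    have "(\<Sum>i\<in>UNIV. \<bar>(w *\<^sub>R \<pi>' - \<pi>) $ i - (w' *\<^sub>R \<pi>' - \<pi>) $ i\<bar>)
        = (\<Sum>i\<in>UNIV. \<bar>w - w'\<bar> * \<pi>' $ i)"
      using \<pi>(2) by (intro sum.cong) (auto simp: weight_simplex_iff abs_mult simp flip: left_diff_distrib)
    also have "\<dots> = \<bar>w - w'\<bar>"
      using \<pi>(2) by (simp add: weight_simplex_iff flip: sum_distrib_left)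
    finally show ?thesis using \<kappa>(3)[of "w *\<^sub>R \<pi>' - \<pi>" "w' *\<^sub>R \<pi>' - \<pi>"] by simp
  qed
  have "cost c h (- \<pi>) < 1"
  proof -
    have "\<bar>cost c h (- \<pi>) - cost c h 0\<bar> \<le> \<kappa> * (\<Sum>i\<in>UNIV. \<bar>\<pi> $ i\<bar>)"
      using \<kappa>(3)[of "- \<pi>" 0] by simp
    also have "\<dots> = \<kappa>"
      using \<pi>(1) by (simp add: weight_simplex_iff)
    finally show ?thesis using \<kappa> by (simp add: cost_def)
  qed
  then have g0: "?g 0 < 1" by simp
  have g1: "1 \<le> ?g 1"
    using cost_nonneg[OF cr, of "\<pi>' - \<pi>"] by simp
  have "continuous_on {0..1} ?g"
    unfolding cost_def by (intro continuous_intros)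
  with g0 g1 obtain w where w: "0 \<le> w" "?g w = 1"
    using IVT'[of ?g 0 1 1] by auto
  with g0 have "0 < w" by (cases "w = 0") auto
  moreover have "w' = w" if "?g w' = 1" for w'
  proof (rule ccontr)
    assume "w' \<noteq> w"
    then have "\<kappa> * \<bar>w - w'\<bar> < 1 * \<bar>w - w'\<bar>"
      using \<kappa> by (intro mult_strict_right_mono) auto
    moreover have "cost c h (w *\<^sub>R \<pi>' - \<pi>) - cost c h (w' *\<^sub>R \<pi>' - \<pi>) = w' - w"
      using w that by linarith
    ultimately show False using lip[of w w'] by (simp add: abs_minus_commute)
  qed
  ultimately show ?thesis using w by blast
qed

lemma wealth_ratio:
  assumes "cost_rates c h" "\<pi> \<in> weight_simplex" "\<pi>' \<in> weight_simplex"
  shows "0 < wealth_ratio c h \<pi> \<pi>'"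
    and "wealth_ratio c h \<pi> \<pi>' + cost c h (wealth_ratio c h \<pi> \<pi>' *\<^sub>R \<pi>' - \<pi>) = 1"
  using theI'[OF wealth_ratio_unique_root[OF assms]] by (auto simp: wealth_ratio_def)

lemma wealth_ratio_le_1:
  assumes "cost_rates c h" "\<pi> \<in> weight_simplex" "\<pi>' \<in> weight_simplex"
  shows "wealth_ratio c h \<pi> \<pi>' \<le> 1"
  using wealth_ratio(2)[OF assms] cost_nonneg[OF assms(1), of "wealth_ratio c h \<pi> \<pi>' *\<^sub>R \<pi>' - \<pi>"]
  by linarith

lemma wealth_ratio_refl:
  assumes "cost_rates c h" "\<pi> \<in> weight_simplex"
  shows "wealth_ratio c h \<pi> \<pi> = 1"
proof -
  have "0 < (1::real) \<and> 1 + cost c h (1 *\<^sub>R \<pi> - \<pi>) = 1"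
    by (simp add: cost_def)
  with wealth_ratio_unique_root[OF assms(1,2,2)] wealth_ratio[OF assms(1,2,2)] show ?thesis
    by blast
qed

text \<open>
  Subtracting the self-financing equations of two pairs of weights bounds the change of the root by
  the change of the weights plus \<open>\<kappa> < 1\<close> times itself. The roots are also at least
  \<open>(1 - \<kappa>) / 2\<close>, where the logarithm is Lipschitz. Taken together with \<open>wealth_ratio_refl\<close>, this also
  bounds the logarithm itself.
\<close>

lemma ln_wealth_ratio_lipschitz:
  fixes c h :: "real^'d::finite"
  assumes cr: "cost_rates c h"
  obtains L where "0 < L"
    "\<And>p q p' q'. p \<in> weight_simplex \<Longrightarrow> q \<in> weight_simplex \<Longrightarrow> p' \<in> weight_simplex \<Longrightarrow> q' \<in> weight_simplex
      \<Longrightarrow> \<bar>ln (wealth_ratio c h p q) - ln (wealth_ratio c h p' q')\<bar> \<le> L * (dist p p' + dist q q')"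
proof -
  obtain \<kappa> where \<kappa>: "0 \<le> \<kappa>" "\<kappa> < 1"
    "\<And>x y. \<bar>cost c h x - cost c h y\<bar> \<le> \<kappa> * (\<Sum>i\<in>UNIV. \<bar>x $ i - y $ i\<bar>)"
    using cost_lipschitz[OF cr] by blast
  let ?l1 = "\<lambda>x :: real^'d. (\<Sum>i\<in>UNIV. \<bar>x $ i\<bar>)"
  let ?s = "wealth_ratio c h"
  define b where "b = (1 - \<kappa>) / 2"
  have b: "0 < b" using \<kappa> by (simp add: b_def)
  have l1_simplex: "?l1 p = 1" if "p \<in> weight_simplex" for p
    using that by (simp add: weight_simplex_iff)
  have l1_tri: "?l1 (x + y) \<le> ?l1 x + ?l1 y" for x y
    by (simp add: sum.distrib[symmetric] sum_mono)
  have l1_scale: "?l1 (a *\<^sub>R x) = \<bar>a\<bar> * ?l1 x" for a x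
    by (simp add: abs_mult sum_distrib_left)
  have lower: "b \<le> ?s p q" if "p \<in> weight_simplex" "q \<in> weight_simplex" for p q
  proof -
    let ?w = "?s p q"
    have w: "0 < ?w" "?w + cost c h (?w *\<^sub>R q - p) = 1"
      using wealth_ratio[OF cr that] by auto
    have "cost c h (?w *\<^sub>R q - p) \<le> \<kappa> * ?l1 (?w *\<^sub>R q - p)"
      using \<kappa>(3)[of "?w *\<^sub>R q - p" 0] by (simp add: cost_def)
    also have "\<dots> \<le> \<kappa> * (?w + 1)"
      using l1_tri[of "?w *\<^sub>R q" "(-1) *\<^sub>R p"] l1_scale[of ?w q] l1_scale[of "-1" p] w(1) \<kappa>(1)
      by (intro mult_left_mono) (simp_all add: l1_simplex that)
    finally have "1 - \<kappa> \<le> ?w * (1 + \<kappa>)" using w(2) by (simp add: algebra_simps)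
    also have "\<dots> \<le> ?w * 2" using w(1) \<kappa> by (intro mult_left_mono) auto
    finally show ?thesis by (simp add: b_def)
  qed
  \<comment> \<open>The factor \<open>CARD('d)\<close> converts the sum norm, in which the cost is Lipschitz, to the Euclidean norm.\<close>
  define L where "L = real CARD('d) / ((1 - \<kappa>) * b)"
  have "0 < L" using \<kappa> b by (simp add: L_def)
  moreover have "\<bar>ln (?s p q) - ln (?s p' q')\<bar> \<le> L * (dist p p' + dist q q')"
    if S: "p \<in> weight_simplex" "q \<in> weight_simplex" "p' \<in> weight_simplex" "q' \<in> weight_simplex"
    for p q p' q'
  proof -
    let ?w = "?s p q" and ?w' = "?s p' q'"
    have eq: "?w *\<^sub>R q - p - (?w' *\<^sub>R q' - p') = (?w - ?w') *\<^sub>R q + ?w' *\<^sub>R (q - q') + (p' - p)"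
      by (simp add: algebra_simps)
    have "\<bar>?w - ?w'\<bar> = \<bar>cost c h (?w *\<^sub>R q - p) - cost c h (?w' *\<^sub>R q' - p')\<bar>"
      using wealth_ratio(2)[OF cr S(1,2)] wealth_ratio(2)[OF cr S(3,4)] by linarith
    also have "\<dots> \<le> \<kappa> * ?l1 (?w *\<^sub>R q - p - (?w' *\<^sub>R q' - p'))"
      using \<kappa>(3)[of "?w *\<^sub>R q - p" "?w' *\<^sub>R q' - p'"] by simp
    also have "\<dots> \<le> \<kappa> * (\<bar>?w - ?w'\<bar> + (?l1 (q - q') + ?l1 (p' - p)))"
    proof (rule mult_left_mono[OF _ \<kappa>(1)])
      have "\<bar>?w'\<bar> * ?l1 (q - q') \<le> 1 * ?l1 (q - q')"
        using wealth_ratio(1)[OF cr S(3,4)] wealth_ratio_le_1[OF cr S(3,4)]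
        by (intro mult_right_mono) (auto intro: sum_nonneg)
      moreover have "?l1 ((?w - ?w') *\<^sub>R q) = \<bar>?w - ?w'\<bar>"
        by (simp only: l1_scale l1_simplex[OF S(2)] mult_1_right)
      ultimately show "?l1 (?w *\<^sub>R q - p - (?w' *\<^sub>R q' - p')) \<le> \<bar>?w - ?w'\<bar> + (?l1 (q - q') + ?l1 (p' - p))"
        unfolding eq
        using l1_tri[of "(?w - ?w') *\<^sub>R q + ?w' *\<^sub>R (q - q')" "p' - p"]
          l1_tri[of "(?w - ?w') *\<^sub>R q" "?w' *\<^sub>R (q - q')"]
          l1_scale[of ?w' "q - q'"]
        by linarith
    qed
    also have "\<dots> \<le> \<kappa> * \<bar>?w - ?w'\<bar> + real CARD('d) * (dist p p' + dist q q')"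
    proof -
      have "?l1 (q - q') + ?l1 (p' - p) \<le> real CARD('d) * (dist p p' + dist q q')"
        using l1_le_card_norm[of "q - q'"] l1_le_card_norm[of "p' - p"]
        by (simp add: dist_norm norm_minus_commute distrib_left)
      moreover have "\<kappa> * (?l1 (q - q') + ?l1 (p' - p)) \<le> 1 * (?l1 (q - q') + ?l1 (p' - p))"
        using \<kappa> by (intro mult_right_mono) (auto intro!: add_nonneg_nonneg sum_nonneg)
      ultimately show ?thesis by (simp add: distrib_left)
    qed
    finally have ww: "(1 - \<kappa>) * \<bar>?w - ?w'\<bar> \<le> real CARD('d) * (dist p p' + dist q q')"
      by (simp add: algebra_simps)
    have ln_le: "ln x - ln y \<le> \<bar>x - y\<bar> / b" if "b \<le> x" "b \<le> y" for x y
    proof -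
      have "ln x - ln y = ln (x / y)" using that b by (simp add: ln_div)
      also have "\<dots> \<le> x / y - 1" using that b by (intro ln_le_minus_one) auto
      also have "\<dots> = (x - y) / y" using that b by (simp add: diff_divide_distrib)
      also have "\<dots> \<le> \<bar>x - y\<bar> / y" using that b by (intro divide_right_mono) auto
      also have "\<dots> \<le> \<bar>x - y\<bar> / b" using that b by (intro divide_left_mono) auto
      finally show ?thesis .
    qed
    have "\<bar>ln ?w - ln ?w'\<bar> \<le> \<bar>?w - ?w'\<bar> / b"
      using ln_le[OF lower[OF S(1,2)] lower[OF S(3,4)]] ln_le[OF lower[OF S(3,4)] lower[OF S(1,2)]]
      by (simp add: abs_le_iff abs_minus_commute)
    also have "\<dots> = ((1 - \<kappa>) * \<bar>?w - ?w'\<bar>) / ((1 - \<kappa>) * b)"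
      using \<kappa> by simp
    also have "\<dots> \<le> (real CARD('d) * (dist p p' + dist q q')) / ((1 - \<kappa>) * b)"
      using ww \<kappa> b by (intro divide_right_mono) auto
    also have "\<dots> = L * (dist p p' + dist q q')"
      by (simp add: L_def)
    finally show ?thesis .
  qed
  ultimately show thesis by (rule that)
qed


section \<open>Measurability\<close>

lemma borel_measurable_vec_lambda:
  fixes f :: "'d::finite \<Rightarrow> 'a \<Rightarrow> real"
  assumes "\<And>i. f i \<in> borel_measurable N"
  shows "(\<lambda>\<omega>. \<chi> i. f i \<omega>) \<in> borel_measurable N"
  using assms by (subst borel_measurable_euclidean_space) (auto simp: Basis_vec_def inner_axis)

lemma borel_measurable_component:
  fixes f :: "'a \<Rightarrow> real^'d::finite"
  shows "f \<in> borel_measurable N \<Longrightarrow> (\<lambda>\<omega>. f \<omega> $ i) \<in> borel_measurable N"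
  by (rule measurable_compose[OF _ borel_measurable_nth])

lemma borel_measurable_exp_comp:
  fixes f :: "'a \<Rightarrow> real"
  shows "f \<in> borel_measurable N \<Longrightarrow> (\<lambda>x. exp (f x)) \<in> borel_measurable N"
  by (rule measurable_compose[OF _ borel_measurable_exp])

lemma borel_measurable_drift:
  assumes "f \<in> borel_measurable N" "g \<in> borel_measurable N"
  shows "(\<lambda>\<omega>. drift (f \<omega>) (g \<omega> :: real^'d::finite)) \<in> borel_measurable N"
proof -
  have "drift x y = (\<chi> i. x $ i * y $ i / (x \<bullet> y))" for x y :: "real^'d"
    by (simp add: drift_def vec_eq_iff)
  then show ?thesis
    using assms by (auto intro!: borel_measurable_vec_lambda borel_measurable_divide borel_measurable_times
        borel_measurable_component borel_measurable_inner)
qed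

lemma borel_measurable_ln_wealth_ratio:
  fixes f g :: "'a \<Rightarrow> real^'d::finite"
  assumes cr: "cost_rates c h"
    and f: "f \<in> borel_measurable N" "\<And>\<omega>. \<omega> \<in> space N \<Longrightarrow> f \<omega> \<in> weight_simplex"
    and g: "g \<in> borel_measurable N" "\<And>\<omega>. \<omega> \<in> space N \<Longrightarrow> g \<omega> \<in> weight_simplex"
  shows "(\<lambda>\<omega>. ln (wealth_ratio c h (f \<omega>) (g \<omega>))) \<in> borel_measurable N"
proof -
  let ?D = "weight_simplex \<times> weight_simplex :: ((real^'d) \<times> (real^'d)) set"
  obtain L where L: "0 < L"
    "\<And>p q p' q'. p \<in> weight_simplex \<Longrightarrow> q \<in> weight_simplex \<Longrightarrow> p' \<in> weight_simplex \<Longrightarrow> q' \<in> weight_simplex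
      \<Longrightarrow> \<bar>ln (wealth_ratio c h p q) - ln (wealth_ratio c h p' q')\<bar> \<le> L * (dist p p' + dist q q')"
    using ln_wealth_ratio_lipschitz[OF cr] by blast
  have "(2 * L)-lipschitz_on ?D (\<lambda>(p, q). ln (wealth_ratio c h p q))"
  proof (rule lipschitz_onI)
    fix x y assume xy: "x \<in> ?D" "y \<in> ?D"
    have "L * (dist (fst x) (fst y) + dist (snd x) (snd y)) \<le> L * (2 * dist x y)"
      using L(1) dist_fst_le[of x y] dist_snd_le[of x y] by (intro mult_left_mono) auto
    with L(2)[of "fst x" "snd x" "fst y" "snd y"] xy
    show "dist (case x of (p, q) \<Rightarrow> ln (wealth_ratio c h p q)) (case y of (p, q) \<Rightarrow> ln (wealth_ratio c h p q))
        \<le> 2 * L * dist x y"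
      by (auto simp: dist_real_def)
  qed (use L in auto)
  then have m: "(\<lambda>(p, q). ln (wealth_ratio c h p q)) \<in> borel_measurable (restrict_space borel ?D)"
    by (intro borel_measurable_continuous_on_restrict lipschitz_on_continuous_on)
  have "(\<lambda>\<omega>. (f \<omega>, g \<omega>)) \<in> measurable N (restrict_space borel ?D)"
    using f g by (intro measurable_restrict_space2 borel_measurable_Pair) auto
  from measurable_compose[OF this m] show ?thesis
    by simp
qed

text \<open>
  The random time is approximated strictly from the right by times in a countable grid; at each of
  these the process is measurable, and right-continuity passes to the limit.
\<close>

lemma borel_measurable_random_time:
  fixes X :: "real \<Rightarrow> 'a \<Rightarrow> 'b::metric_space"
  assumes X: "\<And>t. 0 \<le> t \<Longrightarrow> X t \<in> borel_measurable N"
    and rc: "\<And>\<omega> t. \<omega> \<in> space N \<Longrightarrow> 0 \<le> t \<Longrightarrow> ((\<lambda>u. X u \<omega>) \<longlongrightarrow> X t \<omega>) (at_right t)"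
    and T: "T \<in> borel_measurable N" "\<And>\<omega>. \<omega> \<in> space N \<Longrightarrow> 0 \<le> T \<omega>"
  shows "(\<lambda>\<omega>. X (T \<omega>) \<omega>) \<in> borel_measurable N"
proof (rule borel_measurable_LIMSEQ_metric)
  let ?T = "\<lambda>m \<omega>. real (Suc (nat \<lfloor>real (Suc m) * T \<omega>\<rfloor>)) / real (Suc m)"
  show "(\<lambda>\<omega>. X (?T m \<omega>) \<omega>) \<in> borel_measurable N" for m
    using T(1) by (intro measurable_compose_countable[where f = "\<lambda>i \<omega>. X (real (Suc i) / real (Suc m)) \<omega>"
          and g = "\<lambda>\<omega>. nat \<lfloor>real (Suc m) * T \<omega>\<rfloor>"] X) auto
  fix \<omega> assume \<omega>: "\<omega> \<in> space N"
  have gt: "T \<omega> < ?T m \<omega>" and le: "?T m \<omega> \<le> T \<omega> + 1 / real (Suc m)" for m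
  proof -
    have "0 \<le> real (Suc m) * T \<omega>" using T(2)[OF \<omega>] by simp
    then have n: "real (nat \<lfloor>real (Suc m) * T \<omega>\<rfloor>) = of_int \<lfloor>real (Suc m) * T \<omega>\<rfloor>"
      by (metis of_nat_nat zero_le_floor)
    have "real (Suc m) * T \<omega> < real (Suc (nat \<lfloor>real (Suc m) * T \<omega>\<rfloor>))"
      using n by (simp only: of_nat_Suc) linarith
    then show "T \<omega> < ?T m \<omega>" by (simp add: pos_less_divide_eq mult.commute del: of_nat_Suc)
    have "real (Suc (nat \<lfloor>real (Suc m) * T \<omega>\<rfloor>)) \<le> real (Suc m) * T \<omega> + 1"
      using n by (simp only: of_nat_Suc) linarith
    then show "?T m \<omega> \<le> T \<omega> + 1 / real (Suc m)"
      by (simp add: field_simps del: of_nat_Suc)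
  qed
  have "(\<lambda>m. T \<omega> + 1 / real (Suc m)) \<longlonglongrightarrow> T \<omega> + 0"
    by (intro tendsto_add tendsto_const LIMSEQ_Suc[OF lim_1_over_n])
  then have upper: "(\<lambda>m. T \<omega> + 1 / real (Suc m)) \<longlonglongrightarrow> T \<omega>"
    by simp
  have "(\<lambda>m. ?T m \<omega>) \<longlonglongrightarrow> T \<omega>"
  proof (rule tendsto_sandwich[OF _ _ tendsto_const upper])
    show "\<forall>\<^sub>F m in sequentially. T \<omega> \<le> ?T m \<omega>"
      by (intro always_eventually allI less_imp_le gt)
    show "\<forall>\<^sub>F m in sequentially. ?T m \<omega> \<le> T \<omega> + 1 / real (Suc m)"
      by (intro always_eventually allI le)
  qed
  then have "filterlim (\<lambda>m. ?T m \<omega>) (at_right (T \<omega>)) sequentially"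
    unfolding filterlim_at using gt
    by (auto simp del: of_nat_Suc intro!: always_eventually) (metis less_irrefl)
  then show "(\<lambda>m. X (?T m \<omega>) \<omega>) \<longlonglongrightarrow> X (T \<omega>) \<omega>"
    using rc[OF \<omega> T(2)[OF \<omega>]] by (rule filterlim_compose[rotated])
qed

text \<open>
  Choosing maximisers pointwise would raise a measurability problem. Both sides vary little over
  short distances, so it suffices to choose one near-optimal point for each member of a countable
  cover by small balls; the selector then takes countably many values.
\<close>

lemma measurable_near_optimal_selection:
  fixes F :: "'a::{metric_space, second_countable_topology} \<Rightarrow> 'b::topological_space \<Rightarrow> real"
  assumes F: "\<And>p p' q. p \<in> A \<Longrightarrow> p' \<in> A \<Longrightarrow> q \<in> B \<Longrightarrow> \<bar>F p q - F p' q\<bar> \<le> L * dist p p'"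
    and u: "\<And>p p'. p \<in> A \<Longrightarrow> p' \<in> A \<Longrightarrow> \<bar>u p - u p'\<bar> \<le> L * dist p p'"
    and opt: "\<And>p e. p \<in> A \<Longrightarrow> 0 < e \<Longrightarrow> \<exists>q\<in>B. u p - e \<le> F p q"
    and L: "0 < L" and "A \<noteq> {}" "0 < \<epsilon>"
  obtains \<sigma> where "\<sigma> \<in> borel_measurable borel" "\<And>p. \<sigma> p \<in> B" "\<And>p. p \<in> A \<Longrightarrow> u p - \<epsilon> \<le> F p (\<sigma> p)"
proof -
  obtain D :: "'a set" where D: "countable D" "\<And>X. open X \<Longrightarrow> X \<noteq> {} \<Longrightarrow> \<exists>d\<in>D. d \<in> X"
    by (rule countable_dense_setE) blast
  have "D \<noteq> {}" using D(2)[of UNIV] by auto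
  define d where "d = from_nat_into D"
  \<comment> \<open>A point and the chosen representative of its ball are within \<open>2 * \<delta>\<close>, so moving between them costs \<open>\<epsilon> / 4\<close> twice.\<close>
  define \<delta> where "\<delta> = \<epsilon> / (8 * L)"
  have \<delta>: "0 < \<delta>" using assms by (simp add: \<delta>_def)
  have near: "\<exists>k. dist p (d k) < \<delta>" for p
  proof -
    obtain x where "x \<in> D" "x \<in> ball p \<delta>"
      using D(2)[of "ball p \<delta>"] \<delta> by auto
    then show ?thesis
      using from_nat_into_surj[OF D(1), of x] by (auto simp: d_def)
  qed
  have "\<forall>k. \<exists>p. p \<in> A \<and> ((\<exists>p\<in>A. dist p (d k) < \<delta>) \<longrightarrow> dist p (d k) < \<delta>)"
    using assms by blast
  then obtain c where "\<forall>k. c k \<in> A \<and> ((\<exists>p\<in>A. dist p (d k) < \<delta>) \<longrightarrow> dist (c k) (d k) < \<delta>)"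
    by (auto dest: choice)
  then have c: "c k \<in> A" "p \<in> A \<Longrightarrow> dist p (d k) < \<delta> \<Longrightarrow> dist (c k) (d k) < \<delta>" for k p
    by blast+
  have "\<exists>q\<in>B. u (c k) - \<epsilon> / 2 \<le> F (c k) q" for k
    using opt[OF c(1), of "\<epsilon> / 2"] assms by simp
  then obtain g where g: "\<And>k. g k \<in> B" "\<And>k. u (c k) - \<epsilon> / 2 \<le> F (c k) (g k)"
    by metis
  define \<sigma> where "\<sigma> p = g (LEAST k. dist p (d k) < \<delta>)" for p
  show thesis
  proof (rule that[of \<sigma>])
    have "(\<lambda>p. LEAST k. dist p (d k) < \<delta>) \<in> measurable borel (count_space UNIV)"
      by measurable
    then show "\<sigma> \<in> borel_measurable borel"
      unfolding \<sigma>_def[abs_def] by (rule measurable_compose) simp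
    show "\<sigma> p \<in> B" for p by (simp add: \<sigma>_def g)
    fix p assume p: "p \<in> A"
    define k where "k = (LEAST k. dist p (d k) < \<delta>)"
    have k: "dist p (d k) < \<delta>" unfolding k_def using near by (rule LeastI_ex)
    have "dist p (c k) \<le> 2 * \<delta>"
      using dist_triangle2[of p "c k" "d k"] k c(2)[OF p k] by simp
    then have "L * dist p (c k) \<le> L * (2 * \<delta>)" using L by (intro mult_left_mono) auto
    also have "\<dots> = \<epsilon> / 4" using L by (simp add: \<delta>_def)
    finally have "L * dist p (c k) \<le> \<epsilon> / 4" .
    then show "u p - \<epsilon> \<le> F p (\<sigma> p)"
      using F[OF p c(1) g(1), of k k] u[OF p c(1), of k] g(2)[of k]
      unfolding \<sigma>_def k_def[symmetric] abs_le_iff by linarith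
  qed
qed


section \<open>Entropic utility\<close>

lemma (in prob_space) exp_entropic_utility:
  assumes "integrable M (\<lambda>\<omega>. exp (\<gamma> * Z \<omega>))" "\<gamma> \<noteq> 0"
  shows "0 < (\<integral>\<omega>. exp (\<gamma> * Z \<omega>) \<partial>M)"
    and "exp (\<gamma> * entropic_utility M \<gamma> Z) = (\<integral>\<omega>. exp (\<gamma> * Z \<omega>) \<partial>M)"
proof -
  have "(\<integral>\<omega>. exp (\<gamma> * Z \<omega>) \<partial>M) \<noteq> 0"
    using integral_nonneg_eq_0_iff_AE[OF assms(1)] by simp
  then show pos: "0 < (\<integral>\<omega>. exp (\<gamma> * Z \<omega>) \<partial>M)"
    by (simp add: less_le)
  show "exp (\<gamma> * entropic_utility M \<gamma> Z) = (\<integral>\<omega>. exp (\<gamma> * Z \<omega>) \<partial>M)"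
    using pos assms(2) by (simp add: entropic_utility_def)
qed

lemma (in prob_space) nn_integral_exp_entropic:
  assumes "integrable M (\<lambda>\<omega>. exp (\<gamma> * Z \<omega>))" "\<gamma> \<noteq> 0"
  shows "(\<integral>\<^sup>+\<omega>. ennreal (exp (\<gamma> * Z \<omega>)) \<partial>M) = ennreal (exp (\<gamma> * entropic_utility M \<gamma> Z))"
  using assms by (simp add: nn_integral_eq_integral exp_entropic_utility)

text \<open>
  Jensen's inequality, from the tangent of the exponential at the mean.
\<close>

lemma (in prob_space) entropic_le_expectation:
  assumes Z: "integrable M Z" and e: "integrable M (\<lambda>\<omega>. exp (\<gamma> * Z \<omega>))" and "\<gamma> < 0"
  shows "entropic_utility M \<gamma> Z \<le> entropic_utility M 0 Z"
proof -
  let ?m = "\<integral>\<omega>. Z \<omega> \<partial>M" and ?I = "\<integral>\<omega>. exp (\<gamma> * Z \<omega>) \<partial>M"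
  have "(\<integral>\<omega>. exp (\<gamma> * ?m) * (1 + \<gamma> * (Z \<omega> - ?m)) \<partial>M) \<le> ?I"
  proof (rule integral_mono)
    fix \<omega>
    have "exp (\<gamma> * ?m) * (1 + \<gamma> * (Z \<omega> - ?m)) \<le> exp (\<gamma> * ?m) * exp (\<gamma> * (Z \<omega> - ?m))"
      by (intro mult_left_mono exp_ge_add_one_self) auto
    then show "exp (\<gamma> * ?m) * (1 + \<gamma> * (Z \<omega> - ?m)) \<le> exp (\<gamma> * Z \<omega>)"
      by (simp add: algebra_simps flip: exp_add)
  qed (use Z e in auto)
  also have "(\<integral>\<omega>. exp (\<gamma> * ?m) * (1 + \<gamma> * (Z \<omega> - ?m)) \<partial>M) = exp (\<gamma> * ?m)"
    using Z by (simp add: prob_space)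
  finally have "\<gamma> * ?m \<le> ln ?I"
    using exp_entropic_utility(1)[OF e] assms(3) by (simp add: ln_ge_iff)
  then show ?thesis
    using assms(3) by (simp add: entropic_utility_def field_simps)
qed

lemma (in prob_space) entropic_ge_difference_quotient:
  assumes e: "integrable M (\<lambda>\<omega>. exp (\<gamma> * Z \<omega>))" and "\<gamma> < 0"
  shows "((\<integral>\<omega>. exp (\<gamma> * Z \<omega>) \<partial>M) - 1) / \<gamma> \<le> entropic_utility M \<gamma> Z"
proof -
  have "ln (\<integral>\<omega>. exp (\<gamma> * Z \<omega>) \<partial>M) \<le> (\<integral>\<omega>. exp (\<gamma> * Z \<omega>) \<partial>M) - 1"
    using exp_entropic_utility(1)[OF e] assms(2) by (intro ln_le_minus_one) auto
  then show ?thesis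
    using assms(2) by (simp add: entropic_utility_def divide_right_mono_neg)
qed

text \<open>
  The derivative of \<open>exp (\<gamma> * z)\<close> in \<open>\<gamma>\<close> at \<open>0\<close> is \<open>z\<close>. Convexity makes the difference quotients
  monotone in \<open>\<gamma>\<close>, so for \<open>-1 < \<gamma> < 0\<close> they lie between \<open>1 - exp (- z)\<close> and \<open>z\<close>, which provides the
  dominating function.
\<close>

lemma (in prob_space) tendsto_difference_quotient_expectation:
  fixes Z :: "'a \<Rightarrow> real"
  assumes Z: "integrable M Z" and e: "\<And>\<gamma>. \<gamma> < 0 \<Longrightarrow> integrable M (\<lambda>\<omega>. exp (\<gamma> * Z \<omega>))"
  shows "((\<lambda>\<gamma>. ((\<integral>\<omega>. exp (\<gamma> * Z \<omega>) \<partial>M) - 1) / \<gamma>) \<longlongrightarrow> (\<integral>\<omega>. Z \<omega> \<partial>M)) (at_left 0)"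
proof (rule tendsto_at_left_sequentially[where b = "- 1 :: real"])
  fix g :: "nat \<Rightarrow> real"
  assume g: "\<And>n. g n < 0" "\<And>n. - 1 < g n" "g \<longlonglongrightarrow> 0"
  have "(\<lambda>n. \<integral>\<omega>. (exp (g n * Z \<omega>) - 1) / g n \<partial>M) \<longlonglongrightarrow> (\<integral>\<omega>. Z \<omega> \<partial>M)"
  proof (rule integral_dominated_convergence[where w = "\<lambda>\<omega>. \<bar>Z \<omega>\<bar> + 1 + exp (- 1 * Z \<omega>)"])
    show "Z \<in> borel_measurable M" using Z by auto
    show "(\<lambda>\<omega>. (exp (g n * Z \<omega>) - 1) / g n) \<in> borel_measurable M" for n
      using borel_measurable_integrable[OF e[OF g(1)]] by measurable
    show "integrable M (\<lambda>\<omega>. \<bar>Z \<omega>\<bar> + 1 + exp (- 1 * Z \<omega>))"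
      using Z e[of "-1"] by (intro Bochner_Integration.integrable_add) auto
    show "AE \<omega> in M. (\<lambda>n. (exp (g n * Z \<omega>) - 1) / g n) \<longlonglongrightarrow> Z \<omega>"
    proof (rule AE_I2)
      fix \<omega>
      have "((\<lambda>x. exp (x * Z \<omega>)) has_field_derivative Z \<omega>) (at 0)"
        by (auto intro!: derivative_eq_intros)
      then have "((\<lambda>x. (exp (x * Z \<omega>) - 1) / x) \<longlongrightarrow> Z \<omega>) (at 0)"
        by (simp add: has_field_derivative_iff)
      moreover have "filterlim g (at 0) sequentially"
        unfolding filterlim_at using g by (auto intro!: always_eventually) (metis less_irrefl)
      ultimately show "(\<lambda>n. (exp (g n * Z \<omega>) - 1) / g n) \<longlonglongrightarrow> Z \<omega>"
        by (rule filterlim_compose)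
    qed
    show "AE \<omega> in M. norm ((exp (g n * Z \<omega>) - 1) / g n) \<le> \<bar>Z \<omega>\<bar> + 1 + exp (- 1 * Z \<omega>)" for n
    proof (rule AE_I2)
      fix \<omega>
      let ?z = "Z \<omega>"
      have "?z * g n \<le> exp (g n * ?z) - 1"
        using exp_ge_add_one_self[of "g n * ?z"] by (subst mult.commute) linarith
      then have up: "(exp (g n * ?z) - 1) / g n \<le> ?z"
        using g(1)[of n] by (simp add: divide_le_eq)
      have "exp ((1 - - g n) *\<^sub>R 0 + (- g n) *\<^sub>R (- ?z)) \<le> (1 - - g n) * exp 0 + (- g n) * exp (- ?z)"
        using g(1,2)[of n] less_imp_le by (intro convex_onD[OF exp_convex]) auto
      then have "g n * (1 - exp (- ?z)) \<ge> exp (g n * ?z) - 1"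
        by (simp add: algebra_simps)
      then have "1 - exp (- ?z) \<le> (exp (g n * ?z) - 1) / g n"
        using g(1)[of n] by (simp add: le_divide_eq mult.commute)
      then show "norm ((exp (g n * ?z) - 1) / g n) \<le> \<bar>?z\<bar> + 1 + exp (- 1 * ?z)"
        using up unfolding real_norm_def by (smt (verit) exp_gt_zero mult_minus1)
    qed
  qed
  then show "(\<lambda>n. ((\<integral>\<omega>. exp (g n * Z \<omega>) \<partial>M) - 1) / g n) \<longlonglongrightarrow> (\<integral>\<omega>. Z \<omega> \<partial>M)"
    using e g(1) by (simp add: Bochner_Integration.integral_diff prob_space)
qed simp


section \<open>The market at the rebalancing times\<close>

text \<open>
  If the two arguments are read off independent \<open>\<sigma>\<close>-algebras, one of them may be frozen while the other
  is averaged: under independence the diagonal map pushes the measure forward to the product.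
\<close>

lemma (in prob_space) nn_integral_indep_freeze:
  assumes ind: "indep_set (sets F) (sets H)"
    and sp: "space F = space M" "space H = space M"
    and f: "f \<in> borel_measurable (F \<Otimes>\<^sub>M H)"
  shows "(\<integral>\<^sup>+\<omega>. f (\<omega>, \<omega>) \<partial>M) = (\<integral>\<^sup>+\<omega>. \<integral>\<^sup>+\<omega>'. f (\<omega>, \<omega>') \<partial>M \<partial>M)"
proof -
  have mF: "(\<lambda>\<omega>. \<omega>) \<in> measurable M F" and mH: "(\<lambda>\<omega>. \<omega>) \<in> measurable M H"
    using indep_setD_ev1[OF ind] indep_setD_ev2[OF ind] sp
    by (auto intro!: measurableI simp: Int_absorb2 sets.sets_into_space)
  have vim: "sigma_sets (space M) {(\<lambda>\<omega>. \<omega>) -` A \<inter> space M | A. A \<in> sets N} = sets N"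
    if "space N = space M" for N :: "'a measure"
  proof -
    have "{(\<lambda>\<omega>. \<omega>) -` A \<inter> space M | A. A \<in> sets N} = sets N"
      using that sets.sets_into_space[of _ N] by (auto simp: Int_absorb2)
    then show ?thesis using that sets.sigma_sets_eq[of N] by simp
  qed
  have "indep_var F (\<lambda>\<omega>. \<omega>) H (\<lambda>\<omega>. \<omega>)"
    unfolding indep_var_eq vim[OF sp(1)] vim[OF sp(2)] using ind mF mH by blast
  then have prod: "distr M F (\<lambda>\<omega>. \<omega>) \<Otimes>\<^sub>M distr M H (\<lambda>\<omega>. \<omega>) = distr M (F \<Otimes>\<^sub>M H) (\<lambda>\<omega>. (\<omega>, \<omega>))"
    unfolding indep_var_distribution_eq by simp
  interpret F: prob_space "distr M F (\<lambda>\<omega>. \<omega>)" by (rule prob_space_distr) fact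
  interpret H: prob_space "distr M H (\<lambda>\<omega>. \<omega>)" by (rule prob_space_distr) fact
  have "(\<integral>\<^sup>+\<omega>. f (\<omega>, \<omega>) \<partial>M) = (\<integral>\<^sup>+p. f p \<partial>distr M (F \<Otimes>\<^sub>M H) (\<lambda>\<omega>. (\<omega>, \<omega>)))"
    using f mF mH by (subst nn_integral_distr) auto
  also have "\<dots> = (\<integral>\<^sup>+p. f p \<partial>(distr M F (\<lambda>\<omega>. \<omega>) \<Otimes>\<^sub>M distr M H (\<lambda>\<omega>. \<omega>)))"
    by (simp add: prod)
  also have "\<dots> = (\<integral>\<^sup>+\<omega>. \<integral>\<^sup>+\<omega>'. f (\<omega>, \<omega>') \<partial>distr M H (\<lambda>\<omega>. \<omega>) \<partial>distr M F (\<lambda>\<omega>. \<omega>))"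
    by (rule H.nn_integral_fst[symmetric]) (use f in simp)
  also have "\<dots> = (\<integral>\<^sup>+\<omega>. \<integral>\<^sup>+\<omega>'. f (\<omega>, \<omega>') \<partial>distr M H (\<lambda>\<omega>. \<omega>) \<partial>M)"
    using H.borel_measurable_nn_integral_fst[of f "distr M F (\<lambda>\<omega>. \<omega>)"] f mF
    by (subst nn_integral_distr) auto
  also have "\<dots> = (\<integral>\<^sup>+\<omega>. \<integral>\<^sup>+\<omega>'. f (\<omega>, \<omega>') \<partial>M \<partial>M)"
    using f mH sp by (intro nn_integral_cong nn_integral_distr) auto
  finally show ?thesis .
qed

locale rebalancing_market = prob_space M
  for M :: "'a measure" +
  fixes S :: "real \<Rightarrow> 'a \<Rightarrow> real^'d::finite"
    and \<eta> :: "nat \<Rightarrow> 'a \<Rightarrow> real"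
    and \<G> :: "nat \<Rightarrow> 'a measure"
    and c h :: "real^'d"
  assumes costs: "cost_rates c h"
    and prices: "price_process M S"
    and waiting: "waiting_process M S \<eta>"
    and increments: "increments_cond M S"
    and waiting_times: "waiting_times_cond M \<eta>"
    and integrability: "integrability_cond M S \<eta>"
    and info: "information M S \<eta> \<G>"
begin

abbreviation \<tau> :: "nat \<Rightarrow> 'a \<Rightarrow> real" where "\<tau> \<equiv> jump_time \<eta>"

definition R :: "nat \<Rightarrow> 'a \<Rightarrow> real^'d" where
  "R n \<omega> = price_ratio S (\<tau> n \<omega>) (\<tau> (Suc n) \<omega>) \<omega>"

lemma jump_time_0: "\<tau> 0 \<omega> = 0"
  by (simp add: jump_time_def)

lemma jump_time_Suc: "\<tau> (Suc n) \<omega> = \<tau> n \<omega> + \<eta> (Suc n) \<omega>"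
  by (simp add: jump_time_def)

lemma R_0: "R 0 \<omega> = price_ratio S 0 (\<eta> 1 \<omega>) \<omega>"
  by (simp add: R_def jump_time_Suc jump_time_0)

lemma waiting_pos: "\<omega> \<in> space M \<Longrightarrow> 0 < \<eta> (Suc n) \<omega>"
  using waiting by (simp add: waiting_process_def)

lemma jump_time_nonneg: "\<omega> \<in> space M \<Longrightarrow> 0 \<le> \<tau> n \<omega>"
  by (induction n) (auto simp: jump_time_0 jump_time_Suc intro!: add_nonneg_nonneg less_imp_le[OF waiting_pos])

lemma price_pos: "\<omega> \<in> space M \<Longrightarrow> 0 \<le> t \<Longrightarrow> 0 < S t \<omega> $ i"
  using prices by (simp add: price_process_def)

lemma price_ratio_pos:
  "\<omega> \<in> space M \<Longrightarrow> 0 \<le> t \<Longrightarrow> 0 \<le> u \<Longrightarrow> 0 < price_ratio S t u \<omega> $ i"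
  using price_pos by (simp add: price_ratio_def)

lemma R_pos: "\<omega> \<in> space M \<Longrightarrow> 0 < R n \<omega> $ i"
  unfolding R_def by (intro price_ratio_pos jump_time_nonneg)

lemma subalgebra_info: "subalgebra M (\<G> n)"
  using info by (simp add: information_def)

lemma space_info [simp]: "space (\<G> n) = space M"
  using subalgebra_info by (simp add: subalgebra_def)

lemma info_Suc: "f \<in> measurable (\<G> n) N \<Longrightarrow> f \<in> measurable (\<G> (Suc n)) N"
  using info by (auto simp: information_def intro: measurable_from_subalg)

lemma info_M: "f \<in> measurable (\<G> n) N \<Longrightarrow> f \<in> measurable M N"
  using subalgebra_info by (rule measurable_from_subalg)

text \<open>
  For large \<open>m\<close> the price stopped at \<open>\<tau> n\<close> and read at time \<open>m\<close> is the price at \<open>\<tau> n\<close>.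
\<close>

lemma price_info: "(\<lambda>\<omega>. S (\<tau> n \<omega>) \<omega>) \<in> borel_measurable (\<G> n)"
proof (rule borel_measurable_LIMSEQ_metric)
  show "(\<lambda>\<omega>. S (min (real m) (\<tau> n \<omega>)) \<omega>) \<in> borel_measurable (\<G> n)" for m
    using info by (simp add: information_def)
  fix \<omega>
  have "eventually (\<lambda>m. S (min (real m) (\<tau> n \<omega>)) \<omega> = S (\<tau> n \<omega>) \<omega>) sequentially"
    using eventually_ge_at_top[of "nat \<lceil>\<tau> n \<omega>\<rceil>"]
    by eventually_elim (simp add: min_absorb2 nat_ceiling_le_eq)
  then show "(\<lambda>m. S (min (real m) (\<tau> n \<omega>)) \<omega>) \<longlonglongrightarrow> S (\<tau> n \<omega>) \<omega>"
    by (rule tendsto_eventually)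
qed

lemma R_info: "R n \<in> borel_measurable (\<G> (Suc n))"
  unfolding R_def[abs_def] price_ratio_def
  by (intro borel_measurable_vec_lambda borel_measurable_divide borel_measurable_component
      price_info info_Suc[OF price_info])

lemma R_measurable: "R n \<in> borel_measurable M"
  by (rule info_M[OF R_info])

lemma price_right_continuous:
  assumes "\<omega> \<in> space M" "0 \<le> t"
  shows "((\<lambda>u. S u \<omega>) \<longlongrightarrow> S t \<omega>) (at_right t)"
proof -
  have "((\<lambda>u. log_price S u \<omega>) \<longlongrightarrow> log_price S t \<omega>) (at_right t)"
    using increments assms by (auto simp: increments_cond_def continuous_within)
  then have "((\<lambda>u. \<chi> i. exp (log_price S u \<omega> $ i)) \<longlongrightarrow> (\<chi> i. exp (log_price S t \<omega> $ i))) (at_right t)"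
    by (intro tendsto_intros)
  moreover have "(\<chi> i. exp (log_price S u \<omega> $ i)) = S u \<omega>" if "0 \<le> u" for u
    using price_pos[OF assms(1) that] by (simp add: log_price_def vec_eq_iff)
  ultimately show ?thesis
    using assms(2) by (subst tendsto_cong[where g = "\<lambda>u. \<chi> i. exp (log_price S u \<omega> $ i)"])
      (auto intro: eventually_at_right_less[THEN eventually_mono])
qed

lemma price_ratio_right_continuous:
  assumes "\<omega> \<in> space M" "0 \<le> s" "0 \<le> t"
  shows "((\<lambda>u. price_ratio S s (s + u) \<omega>) \<longlongrightarrow> price_ratio S s (s + t) \<omega>) (at_right t)"
proof -
  have "filterlim (\<lambda>u. s + u) (at_right (s + t)) (at_right t)"
    unfolding filterlim_at
    by (auto intro!: tendsto_intros eventually_at_right_less[THEN eventually_mono])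
  then have "((\<lambda>u. S (s + u) \<omega>) \<longlongrightarrow> S (s + t) \<omega>) (at_right t)"
    using price_right_continuous[of \<omega> "s + t"] assms by (auto intro: filterlim_compose)
  then show ?thesis
    unfolding price_ratio_def using price_pos[OF assms(1,2)]
    by (intro tendsto_intros) (auto simp: less_imp_neq[symmetric])
qed

lemma price_at_random_time:
  assumes "\<And>t. 0 \<le> t \<Longrightarrow> S t \<in> borel_measurable N" "space N = space M"
    and "T \<in> borel_measurable K" "\<And>x. x \<in> space K \<Longrightarrow> 0 \<le> T x"
  shows "(\<lambda>(x, \<omega>). S (T x) \<omega>) \<in> borel_measurable (K \<Otimes>\<^sub>M N)"
proof -
  have "(\<lambda>p. S (T (fst p)) (snd p)) \<in> borel_measurable (K \<Otimes>\<^sub>M N)"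
  proof (rule borel_measurable_random_time[where X = "\<lambda>t p. S t (snd p)"])
    show "(\<lambda>p. S t (snd p)) \<in> borel_measurable (K \<Otimes>\<^sub>M N)" if "0 \<le> t" for t
      by (rule measurable_compose[OF measurable_snd assms(1)[OF that]])
    show "(\<lambda>p. T (fst p)) \<in> borel_measurable (K \<Otimes>\<^sub>M N)"
      by (rule measurable_compose[OF measurable_fst assms(3)])
  qed (use assms(2,4) price_right_continuous in \<open>auto simp: space_pair_measure\<close>)
  then show ?thesis by (simp add: split_beta)
qed

lemma nn_integral_price_ratio_stationary:
  assumes f: "f \<in> borel_measurable borel" and t: "0 \<le> t" "0 \<le> u"
  shows "(\<integral>\<^sup>+\<omega>. f (price_ratio S t (t + u) \<omega>) \<partial>M) = (\<integral>\<^sup>+\<omega>. f (price_ratio S 0 u \<omega>) \<partial>M)"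
proof -
  let ?e = "\<lambda>x :: real^'d. \<chi> i. exp (x $ i)"
  have e: "?e \<in> borel_measurable borel"
    by (intro borel_measurable_vec_lambda) measurable
  have S: "S s \<in> borel_measurable M" if "0 \<le> s" for s
    using prices that by (simp add: price_process_def)
  have m: "(\<lambda>\<omega>. log_price S b \<omega> - log_price S a \<omega>) \<in> borel_measurable M" if "0 \<le> a" "0 \<le> b" for a b
    unfolding log_price_def using S[OF that(1)] S[OF that(2)]
    by (intro borel_measurable_diff borel_measurable_vec_lambda borel_measurable_ln borel_measurable_component)
  have pr: "price_ratio S a b \<omega> = ?e (log_price S b \<omega> - log_price S a \<omega>)"
    if "\<omega> \<in> space M" "0 \<le> a" "0 \<le> b" for a b \<omega>
    using price_pos[OF that(1,2)] price_pos[OF that(1,3)]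
    by (simp add: price_ratio_def log_price_def vec_eq_iff exp_diff)
  have "(\<integral>\<^sup>+\<omega>. f (price_ratio S a b \<omega>) \<partial>M) =
      (\<integral>\<^sup>+x. f (?e x) \<partial>distr M borel (\<lambda>\<omega>. log_price S b \<omega> - log_price S a \<omega>))"
    if "0 \<le> a" "0 \<le> b" for a b
  proof -
    have "(\<integral>\<^sup>+x. f (?e x) \<partial>distr M borel (\<lambda>\<omega>. log_price S b \<omega> - log_price S a \<omega>)) =
        (\<integral>\<^sup>+\<omega>. f (?e (log_price S b \<omega> - log_price S a \<omega>)) \<partial>M)"
      by (rule nn_integral_distr) (simp_all add: m that measurable_compose[OF e f])
    also have "\<dots> = (\<integral>\<^sup>+\<omega>. f (price_ratio S a b \<omega>) \<partial>M)"
      by (rule nn_integral_cong) (simp only: pr that)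
    finally show ?thesis by simp
  qed
  from this[of t "t + u"] this[of 0 u] show ?thesis
    using increments t by (simp add: increments_cond_def)
qed

lemma sigma_of_space [simp]: "space (sigma_of M I X) = space M"
  by (simp add: sigma_of_def)

lemma sigma_of_measurable:
  assumes "i \<in> I"
  shows "X i \<in> borel_measurable (sigma_of M I X)"
proof -
  have "(\<lambda>\<omega>. \<lambda>i\<in>I. X i \<omega>) \<in> measurable (sigma_of M I X) (\<Pi>\<^sub>M i\<in>I. borel)"
    unfolding sigma_of_def by (rule measurable_vimage_algebra1) (auto simp: space_PiM)
  from measurable_compose[OF this measurable_component_singleton[OF assms]] show ?thesis
    using assms by simp
qed

text \<open>
  All periods have the same return law. The waiting times are independent of the prices, so
  the two endpoints of the period can be frozen; stationarity of the increments then leaves only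
  the length of the period, whose law is that of \<open>\<eta> 1\<close>.
\<close>

lemma nn_integral_R_eq:
  assumes f: "f \<in> borel_measurable borel"
  shows "(\<integral>\<^sup>+\<omega>. f (R n \<omega>) \<partial>M) = (\<integral>\<^sup>+\<omega>. f (R 0 \<omega>) \<partial>M)"
proof -
  define \<kappa> where "\<kappa> u = (\<integral>\<^sup>+\<omega>. f (price_ratio S 0 (max 0 u) \<omega>) \<partial>M)" for u
  have "(\<integral>\<^sup>+\<omega>. f (R n \<omega>) \<partial>M) = (\<integral>\<^sup>+\<omega>. \<kappa> (\<eta> (Suc n) \<omega>) \<partial>M)" for n
  proof -
    let ?F = "sigma_of M {1..} \<eta>" and ?H = "sigma_of M {0..} S"
    have ind: "indep_set (sets ?F) (sets ?H)"
      using waiting by (simp add: waiting_process_def)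
    have \<tau>: "\<tau> k \<in> borel_measurable ?F" for k
      unfolding jump_time_def[abs_def] by (intro borel_measurable_sum sigma_of_measurable) auto
    have S\<tau>: "(\<lambda>(\<omega>, \<omega>'). S (\<tau> k \<omega>) \<omega>') \<in> borel_measurable (?F \<Otimes>\<^sub>M ?H)" for k
      by (intro price_at_random_time sigma_of_measurable \<tau>) (auto intro: jump_time_nonneg)
    have pr: "(\<lambda>(\<omega>, \<omega>'). f (price_ratio S (\<tau> n \<omega>) (\<tau> (Suc n) \<omega>) \<omega>')) \<in> borel_measurable (?F \<Otimes>\<^sub>M ?H)"
      unfolding split_beta price_ratio_def using S\<tau>[of n] S\<tau>[of "Suc n"]
      by (intro measurable_compose[OF _ f] borel_measurable_vec_lambda borel_measurable_divide borel_measurable_component)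
        (simp_all add: split_beta)
    have "(\<integral>\<^sup>+\<omega>. f (R n \<omega>) \<partial>M) =
        (\<integral>\<^sup>+\<omega>. \<integral>\<^sup>+\<omega>'. f (price_ratio S (\<tau> n \<omega>) (\<tau> (Suc n) \<omega>) \<omega>') \<partial>M \<partial>M)"
      using nn_integral_indep_freeze[OF ind _ _ pr] by (simp add: R_def)
    also have "\<dots> = (\<integral>\<^sup>+\<omega>. \<kappa> (\<eta> (Suc n) \<omega>) \<partial>M)"
    proof (rule nn_integral_cong)
      fix \<omega> assume \<omega>: "\<omega> \<in> space M"
      then have "0 \<le> \<tau> n \<omega>" "0 < \<eta> (Suc n) \<omega>"
        by (auto intro: jump_time_nonneg waiting_pos)
      then show "(\<integral>\<^sup>+\<omega>'. f (price_ratio S (\<tau> n \<omega>) (\<tau> (Suc n) \<omega>) \<omega>') \<partial>M) = \<kappa> (\<eta> (Suc n) \<omega>)"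
        using nn_integral_price_ratio_stationary[OF f, of "\<tau> n \<omega>" "\<eta> (Suc n) \<omega>"]
        by (simp add: \<kappa>_def jump_time_Suc)
    qed
    finally show ?thesis .
  qed
  moreover have "(\<integral>\<^sup>+\<omega>. \<kappa> (\<eta> (Suc n) \<omega>) \<partial>M) = (\<integral>\<^sup>+\<omega>. \<kappa> (\<eta> (Suc 0) \<omega>) \<partial>M)"
  proof -
    have S: "\<And>t. 0 \<le> t \<Longrightarrow> S t \<in> borel_measurable M"
      using prices by (simp add: price_process_def)
    have "(\<lambda>(u, \<omega>). f (price_ratio S 0 (max 0 u) \<omega>)) \<in> borel_measurable (borel \<Otimes>\<^sub>M M)"
      unfolding split_beta price_ratio_def
      using price_at_random_time[OF S, of "\<lambda>u. max 0 u" borel] S[of 0]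
      by (intro measurable_compose[OF _ f] borel_measurable_vec_lambda borel_measurable_divide borel_measurable_component)
        (simp_all add: split_beta)
    then have \<kappa>: "\<kappa> \<in> borel_measurable borel"
      unfolding \<kappa>_def[abs_def] by (rule borel_measurable_nn_integral)
    have \<eta>: "\<eta> (Suc k) \<in> borel_measurable M" for k
      using waiting_times by (auto simp: waiting_times_cond_def)
    have "(\<integral>\<^sup>+\<omega>. \<kappa> (\<eta> (Suc k) \<omega>) \<partial>M) = (\<integral>\<^sup>+u. \<kappa> u \<partial>distr M borel (\<eta> 1))" for k
    proof -
      have "\<forall>i\<ge>1. distr M borel (\<eta> i) = distr M borel (\<eta> 1)"
        using waiting unfolding waiting_process_def by blast
      then have eq: "distr M borel (\<eta> (Suc k)) = distr M borel (\<eta> 1)"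
        by (elim allE[of _ "Suc k"]) simp
      show ?thesis
        unfolding eq[symmetric] by (rule nn_integral_distr[symmetric]) (simp_all add: \<eta> \<kappa>)
    qed
    from this[of n] this[of 0] show ?thesis by simp
  qed
  ultimately show ?thesis by metis
qed

text \<open>
  The Markov property of the rebalancing scheme: the return over the coming period is a functional
  of the future waiting times and relative prices, hence may be replaced by an independent copy of
  the first return. Right-continuity makes this functional, an evaluation of the path at a random
  time, measurable for the product \<open>\<sigma>\<close>-algebra on paths.
\<close>

lemma nn_integral_next_return:
  assumes f: "f \<in> borel_measurable (\<G> n \<Otimes>\<^sub>M borel)"
  shows "(\<integral>\<^sup>+\<omega>. f (\<omega>, R n \<omega>) \<partial>M) = (\<integral>\<^sup>+\<omega>. \<integral>\<^sup>+\<omega>'. f (\<omega>, R 0 \<omega>') \<partial>M \<partial>M)"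
proof -
  let ?P = "(\<Pi>\<^sub>M k\<in>{n<..}. borel :: real measure) \<Otimes>\<^sub>M (\<Pi>\<^sub>M t\<in>{0..}. borel :: (real^'d) measure)"
  let ?X = "\<lambda>\<omega>. (\<lambda>k\<in>{n<..}. \<eta> k \<omega>, \<lambda>t\<in>{0..}. price_ratio S (\<tau> n \<omega>) (\<tau> n \<omega> + t) \<omega>)"
  let ?H = "vimage_algebra (space M) ?X ?P"
  have ind: "indep_set (sets (\<G> n)) (sets ?H)"
    using info by (simp add: information_def)
  have X: "?X \<in> measurable ?H ?P"
    by (rule measurable_vimage_algebra1) (auto simp: space_pair_measure space_PiM)
  have "R n \<in> borel_measurable ?H"
  proof -
    have "(\<lambda>\<omega>. price_ratio S (\<tau> n \<omega>) (\<tau> n \<omega> + \<eta> (Suc n) \<omega>) \<omega>) \<in> borel_measurable ?H"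
    proof (rule borel_measurable_random_time[where X = "\<lambda>t \<omega>. price_ratio S (\<tau> n \<omega>) (\<tau> n \<omega> + t) \<omega>"])
      show "(\<lambda>\<omega>. price_ratio S (\<tau> n \<omega>) (\<tau> n \<omega> + t) \<omega>) \<in> borel_measurable ?H" if "0 \<le> t" for t
        using measurable_compose[OF measurable_compose[OF X measurable_snd]
            measurable_component_singleton[of t "{0..}"]] that by simp
      show "\<eta> (Suc n) \<in> borel_measurable ?H"
        using measurable_compose[OF measurable_compose[OF X measurable_fst]
            measurable_component_singleton[of "Suc n" "{n<..}"]] by simp
    qed (auto intro: price_ratio_right_continuous jump_time_nonneg less_imp_le[OF waiting_pos])
    then show ?thesis by (simp add: R_def[abs_def] jump_time_Suc)
  qed
  then have g: "(\<lambda>(\<omega>, \<omega>'). f (\<omega>, R n \<omega>')) \<in> borel_measurable (\<G> n \<Otimes>\<^sub>M ?H)"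
    unfolding split_beta
    by (intro measurable_compose[OF _ f] measurable_Pair measurable_fst measurable_compose[OF measurable_snd])
  have "(\<integral>\<^sup>+\<omega>. f (\<omega>, R n \<omega>) \<partial>M) = (\<integral>\<^sup>+\<omega>. \<integral>\<^sup>+\<omega>'. f (\<omega>, R n \<omega>') \<partial>M \<partial>M)"
    using nn_integral_indep_freeze[OF ind _ _ g] by simp
  also have "\<dots> = (\<integral>\<^sup>+\<omega>. \<integral>\<^sup>+\<omega>'. f (\<omega>, R 0 \<omega>') \<partial>M \<partial>M)"
    using f by (intro nn_integral_cong nn_integral_R_eq) auto
  finally show ?thesis .
qed

end


section \<open>Integrability of returns and of the payoff of one period\<close>

definition min_log :: "real^'d::finite \<Rightarrow> real" where "min_log x = (MIN i. ln (x $ i))"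
definition max_log :: "real^'d::finite \<Rightarrow> real" where "max_log x = (MAX i. ln (x $ i))"

lemma min_log_measurable: "min_log \<in> borel_measurable borel"
  unfolding min_log_def[abs_def]
  by (intro borel_measurable_Min borel_measurable_ln borel_measurable_component) auto

lemma max_log_measurable: "max_log \<in> borel_measurable borel"
  unfolding max_log_def[abs_def]
  by (intro borel_measurable_Max borel_measurable_ln borel_measurable_component) auto

context rebalancing_market
begin

lemma distr_R: "distr M borel (R n) = distr M borel (R 0)"
proof (rule measure_eqI)
  fix A assume "A \<in> sets (distr M borel (R n))"
  then have A: "A \<in> sets borel" by simp
  have "emeasure (distr M borel (R k)) A = (\<integral>\<^sup>+\<omega>. indicator A (R k \<omega>) \<partial>M)" for k
  proof -
    have "emeasure (distr M borel (R k)) A = (\<integral>\<^sup>+x. indicator A x \<partial>distr M borel (R k))"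
      using A by simp
    also have "\<dots> = (\<integral>\<^sup>+\<omega>. indicator A (R k \<omega>) \<partial>M)"
      by (rule nn_integral_distr[OF R_measurable]) (use A in simp)
    finally show ?thesis .
  qed
  then show "emeasure (distr M borel (R n)) A = emeasure (distr M borel (R 0)) A"
    using nn_integral_R_eq[of "indicator A" n] A by simp
qed simp

lemma integrable_R:
  fixes f :: "real^'d \<Rightarrow> real"
  assumes f: "f \<in> borel_measurable borel" and int: "integrable M (\<lambda>\<omega>. f (R 0 \<omega>))"
  shows "integrable M (\<lambda>\<omega>. f (R n \<omega>))" "(\<integral>\<omega>. f (R n \<omega>) \<partial>M) = (\<integral>\<omega>. f (R 0 \<omega>) \<partial>M)"
proof -
  have "integrable (distr M borel (R n)) f"
    using int integrable_distr_eq[OF R_measurable[of 0] f] by (simp add: distr_R[of n])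
  then show "integrable M (\<lambda>\<omega>. f (R n \<omega>))"
    using integrable_distr_eq[OF R_measurable[of n] f] by simp
  show "(\<integral>\<omega>. f (R n \<omega>) \<partial>M) = (\<integral>\<omega>. f (R 0 \<omega>) \<partial>M)"
    using integral_distr[OF R_measurable[of n] f] integral_distr[OF R_measurable[of 0] f]
    by (simp add: distr_R[of n])
qed

lemma integrable_exp_min_log:
  assumes "\<gamma> < 0"
  shows "integrable M (\<lambda>\<omega>. exp (\<gamma> * min_log (R n \<omega>)))"
proof (rule integrable_R(1))
  show "(\<lambda>x :: real^'d. exp (\<gamma> * min_log x)) \<in> borel_measurable borel"
    by (intro borel_measurable_exp_comp borel_measurable_times borel_measurable_const min_log_measurable)
  show "integrable M (\<lambda>\<omega>. exp (\<gamma> * min_log (R 0 \<omega>)))"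
    using integrability assms by (simp add: R_0 integrability_cond_def log_return_def min_log_def)
qed

lemma integrable_max_log:
  "integrable M (\<lambda>\<omega>. max_log (R n \<omega>))"
  "(\<integral>\<omega>. max_log (R n \<omega>) \<partial>M) = (\<integral>\<omega>. max_log (R 0 \<omega>) \<partial>M)"
proof -
  have "integrable M (\<lambda>\<omega>. max_log (R 0 \<omega>))"
    using integrability by (simp add: R_0 integrability_cond_def log_return_def max_log_def)
  then show "integrable M (\<lambda>\<omega>. max_log (R n \<omega>))"
    "(\<integral>\<omega>. max_log (R n \<omega>) \<partial>M) = (\<integral>\<omega>. max_log (R 0 \<omega>) \<partial>M)"
    using integrable_R[OF max_log_measurable] by auto
qed

lemma portfolio_return_bounds:
  assumes "\<omega> \<in> space M" "q \<in> weight_simplex"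
  shows "min_log (R n \<omega>) \<le> ln (q \<bullet> R n \<omega>)" "ln (q \<bullet> R n \<omega>) \<le> max_log (R n \<omega>)"
  using ln_inner_simplex_bounds[OF assms(2), of "R n \<omega>"] R_pos[OF assms(1)]
  by (auto simp: min_log_def max_log_def)

lemma drift_R_in_simplex:
  "\<omega> \<in> space M \<Longrightarrow> q \<in> weight_simplex \<Longrightarrow> drift q (R n \<omega>) \<in> weight_simplex"
  by (rule drift_in_simplex) (auto intro: R_pos)

definition mean_wait :: real where "mean_wait = (\<integral>\<omega>. \<eta> 1 \<omega> \<partial>M)"

lemma mean_wait_pos: "0 < mean_wait"
proof -
  have i: "integrable M (\<eta> 1)"
    using waiting_times by (simp add: waiting_times_cond_def)
  have ae: "AE \<omega> in M. 0 < \<eta> 1 \<omega>"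
    using waiting_times by (simp add: waiting_times_cond_def)
  have nonneg: "AE \<omega> in M. 0 \<le> \<eta> 1 \<omega>"
    using ae by eventually_elim simp
  have "mean_wait \<noteq> 0"
  proof
    assume "mean_wait = 0"
    then have "AE \<omega> in M. \<eta> 1 \<omega> = 0"
      unfolding mean_wait_def using integral_nonneg_eq_0_iff_AE[OF i nonneg] by blast
    with ae have "AE \<omega> in M. False" by eventually_elim simp
    then show False by simp
  qed
  moreover have "0 \<le> mean_wait"
    unfolding mean_wait_def using nonneg by (rule integral_nonneg_AE)
  ultimately show ?thesis by simp
qed

lemma expectation_jump_time: "(\<integral>\<omega>. \<tau> n \<omega> \<partial>M) = real n * mean_wait"
proof -
  have i: "integrable M (\<eta> k)" if "1 \<le> k" for k
    using waiting_times that by (simp add: waiting_times_cond_def)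
  have "(\<integral>\<omega>. \<eta> k \<omega> \<partial>M) = mean_wait" if k: "1 \<le> k" for k
  proof -
    have "\<forall>i\<ge>1. distr M borel (\<eta> i) = distr M borel (\<eta> 1)"
      using waiting unfolding waiting_process_def by blast
    then have eq: "distr M borel (\<eta> k) = distr M borel (\<eta> 1)"
      using k by (elim allE[of _ k]) simp
    have "(\<integral>\<omega>. \<eta> j \<omega> \<partial>M) = (\<integral>x. x \<partial>distr M borel (\<eta> j))" if "1 \<le> j" for j
      using i[OF that] by (intro integral_distr[symmetric]) auto
    from this[OF k] this[of 1] show ?thesis by (simp add: eq mean_wait_def)
  qed
  then show ?thesis
    using i by (simp add: jump_time_def Bochner_Integration.integral_sum)
qed

definition period_payoff :: "(real^'d \<Rightarrow> real) \<Rightarrow> real^'d \<Rightarrow> 'a \<Rightarrow> real" where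
  "period_payoff u q \<omega> = ln (q \<bullet> R 0 \<omega>) + u (drift q (R 0 \<omega>))"

lemma integrable_exp_period_payoff:
  assumes q: "q \<in> weight_simplex" and u: "u \<in> borel_measurable borel"
    and B: "\<And>p. p \<in> weight_simplex \<Longrightarrow> \<bar>u p\<bar> \<le> B" and \<gamma>: "\<gamma> < 0"
  shows "integrable M (\<lambda>\<omega>. exp (\<gamma> * period_payoff u q \<omega>))"
proof (rule Bochner_Integration.integrable_bound)
  show "integrable M (\<lambda>\<omega>. exp (\<gamma> * min_log (R 0 \<omega>)) * exp (- \<gamma> * B))"
    using integrable_exp_min_log[OF \<gamma>] by simp
  show "(\<lambda>\<omega>. exp (\<gamma> * period_payoff u q \<omega>)) \<in> borel_measurable M"
    unfolding period_payoff_def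
    by (intro borel_measurable_exp_comp borel_measurable_times borel_measurable_const borel_measurable_add
        borel_measurable_ln borel_measurable_inner R_measurable measurable_compose[OF _ u] borel_measurable_drift)
  show "AE \<omega> in M. norm (exp (\<gamma> * period_payoff u q \<omega>)) \<le> norm (exp (\<gamma> * min_log (R 0 \<omega>)) * exp (- \<gamma> * B))"
  proof (rule AE_I2)
    fix \<omega> assume \<omega>: "\<omega> \<in> space M"
    have "min_log (R 0 \<omega>) - B \<le> period_payoff u q \<omega>"
      using portfolio_return_bounds(1)[OF \<omega> q, of 0] B[OF drift_R_in_simplex[OF \<omega> q, of 0]]
      unfolding period_payoff_def by linarith
    then have "\<gamma> * period_payoff u q \<omega> \<le> \<gamma> * (min_log (R 0 \<omega>) - B)"
      using \<gamma> by (intro mult_left_mono_neg) auto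
    then show "norm (exp (\<gamma> * period_payoff u q \<omega>)) \<le> norm (exp (\<gamma> * min_log (R 0 \<omega>)) * exp (- \<gamma> * B))"
      by (simp add: algebra_simps flip: exp_add)
  qed
qed

end


section \<open>Log-wealth of a strategy\<close>

text \<open>
  A sum of \<open>n\<close> terms is at most \<open>n\<close> times the largest one. Exponential moments of log-wealth thereby reduce
  to those of single periods, of \<open>n\<close> times the order.
\<close>

lemma exp_sum_le_sum_exp:
  fixes b :: "nat \<Rightarrow> real"
  assumes "0 < n"
  shows "exp (\<Sum>i<n. b i) \<le> (\<Sum>i<n. exp (real n * b i))"
proof -
  have "(MAX i\<in>{..<n}. b i) \<in> b ` {..<n}"
    using assms by (intro Max_in) auto
  then obtain k where k: "k < n" "(MAX i\<in>{..<n}. b i) = b k" by auto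
  have "b i \<le> b k" if "i < n" for i
    using that Max_ge[of "b ` {..<n}" "b i"] k(2) by simp
  then have "(\<Sum>i<n. b i) \<le> real n * b k"
    using sum_bounded_above[of "{..<n}" b "b k"] by simp
  also have "exp (real n * b k) \<le> (\<Sum>i<n. exp (real n * b i))"
    using k(1) by (intro member_le_sum) auto
  finally show ?thesis by simp
qed

locale rebalanced_portfolio = rebalancing_market M S \<eta> \<G> c h
  for M :: "'a measure" and S :: "real \<Rightarrow> 'a \<Rightarrow> real^'d::finite" and \<eta> \<G> c h +
  fixes \<pi> :: "real^'d" and W :: "real \<Rightarrow> 'a \<Rightarrow> real^'d"
  assumes initial: "\<pi> \<in> weight_simplex"
    and strategy: "W \<in> strategies M S \<eta> \<G> \<pi>"
begin

abbreviation w :: "nat \<Rightarrow> 'a \<Rightarrow> real^'d" where "w n \<omega> \<equiv> W (\<tau> n \<omega>) \<omega>"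
abbreviation pre :: "nat \<Rightarrow> 'a \<Rightarrow> real^'d" where "pre \<equiv> pre_weight S \<eta> W \<pi>"
abbreviation X :: "nat \<Rightarrow> 'a \<Rightarrow> real" where "X \<equiv> log_wealth S \<eta> c h W \<pi>"
abbreviation s :: "nat \<Rightarrow> 'a \<Rightarrow> real" where "s n \<omega> \<equiv> ln (wealth_ratio c h (pre n \<omega>) (w n \<omega>))"

lemma weight_in_simplex: "\<omega> \<in> space M \<Longrightarrow> w n \<omega> \<in> weight_simplex"
  using strategy jump_time_nonneg by (auto simp: strategies_def)

lemma weight_info: "w n \<in> borel_measurable (\<G> n)"
  using strategy by (auto simp: strategies_def)

lemma pre_weight_Suc: "pre (Suc n) \<omega> = drift (w n \<omega>) (R n \<omega>)"
  by (simp add: R_def)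

lemma pre_weight_in_simplex: "\<omega> \<in> space M \<Longrightarrow> pre n \<omega> \<in> weight_simplex"
  by (cases n) (auto simp: initial pre_weight_Suc weight_in_simplex drift_R_in_simplex simp del: pre_weight.simps(2))

lemma pre_weight_info: "pre n \<in> borel_measurable (\<G> n)"
proof (cases n)
  case 0
  moreover have "pre 0 = (\<lambda>_. \<pi>)" by (rule ext) simp
  ultimately show ?thesis by simp
next
  case (Suc m)
  have "(\<lambda>\<omega>. drift (w m \<omega>) (R m \<omega>)) \<in> borel_measurable (\<G> (Suc m))"
    by (intro borel_measurable_drift info_Suc[OF weight_info] R_info)
  then show ?thesis unfolding Suc by (subst measurable_cong[OF pre_weight_Suc])
qed

lemma log_wealth_0: "X 0 \<omega> = 0"
  by (simp add: log_wealth_def)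

lemma log_wealth_Suc: "X (Suc n) \<omega> = X n \<omega> + s n \<omega> + ln (w n \<omega> \<bullet> R n \<omega>)"
  by (simp add: log_wealth_def R_def)

lemma log_cost_info: "s n \<in> borel_measurable (\<G> n)"
  by (intro borel_measurable_ln_wealth_ratio costs pre_weight_info weight_info) (auto intro: pre_weight_in_simplex weight_in_simplex)

lemma log_wealth_info: "X n \<in> borel_measurable (\<G> n)"
proof (induction n)
  case 0
  have "X 0 = (\<lambda>_. 0)" by (rule ext) (rule log_wealth_0)
  then show ?case by simp
next
  case (Suc n)
  have "(\<lambda>\<omega>. X n \<omega> + s n \<omega> + ln (w n \<omega> \<bullet> R n \<omega>)) \<in> borel_measurable (\<G> (Suc n))"
    by (intro borel_measurable_add borel_measurable_ln borel_measurable_inner R_info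
        info_Suc[OF Suc] info_Suc[OF log_cost_info] info_Suc[OF weight_info])
  then show ?case by (subst measurable_cong[OF log_wealth_Suc])
qed

lemma log_wealth_le_sum_max_log: "\<omega> \<in> space M \<Longrightarrow> X n \<omega> \<le> (\<Sum>i<n. max_log (R i \<omega>))"
proof (induction n)
  case (Suc n)
  have "s n \<omega> \<le> 0"
    using wealth_ratio_le_1[OF costs pre_weight_in_simplex weight_in_simplex] wealth_ratio(1)[OF costs pre_weight_in_simplex weight_in_simplex]
      Suc.prems by simp
  then show ?case
    using Suc portfolio_return_bounds(2)[OF Suc.prems weight_in_simplex[OF Suc.prems], of n n] by (simp add: log_wealth_Suc)
qed (simp add: log_wealth_0)

text \<open>
  The loss from one rebalancing is bounded because rebalancing to the current weight is free and
  \<open>ln s\<close> is Lipschitz.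
\<close>

lemma log_wealth_ge_sum_min_log:
  obtains K where "\<And>n \<omega>. \<omega> \<in> space M \<Longrightarrow> (\<Sum>i<n. min_log (R i \<omega>) - K) \<le> X n \<omega>"
proof -
  obtain L where L: "0 < L"
    "\<And>p q p' q'. p \<in> weight_simplex \<Longrightarrow> q \<in> weight_simplex \<Longrightarrow> p' \<in> weight_simplex \<Longrightarrow> q' \<in> weight_simplex
      \<Longrightarrow> \<bar>ln (wealth_ratio c h p q) - ln (wealth_ratio c h p' q')\<bar> \<le> L * (dist p p' + dist q q')"
    using ln_wealth_ratio_lipschitz[OF costs] by blast
  have s: "- (2 * L) \<le> s n \<omega>" if \<omega>: "\<omega> \<in> space M" for n \<omega>
  proof -
    have "\<bar>s n \<omega>\<bar> \<le> L * dist (w n \<omega>) (pre n \<omega>)"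
      using L(2)[OF pre_weight_in_simplex weight_in_simplex pre_weight_in_simplex pre_weight_in_simplex, OF \<omega> \<omega> \<omega> \<omega>, of n n n n]
        wealth_ratio_refl[OF costs pre_weight_in_simplex[OF \<omega>]] by simp
    also have "\<dots> \<le> L * 2"
      using weight_simplex_dist_le_2[OF weight_in_simplex pre_weight_in_simplex, OF \<omega> \<omega>] L(1) by (intro mult_left_mono) auto
    finally show ?thesis by simp
  qed
  have "(\<Sum>i<n. min_log (R i \<omega>) - 2 * L) \<le> X n \<omega>" if \<omega>: "\<omega> \<in> space M" for n \<omega>
  proof (induction n)
    case (Suc n)
    then show ?case
      using s[OF \<omega>, of n] portfolio_return_bounds(1)[OF \<omega> weight_in_simplex[OF \<omega>], of n n] by (simp add: log_wealth_Suc)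
  qed (simp add: log_wealth_0)
  then show thesis by (rule that)
qed

lemma integrable_exp_log_wealth:
  assumes \<gamma>: "\<gamma> < 0"
  shows "integrable M (\<lambda>\<omega>. exp (\<gamma> * X n \<omega>))"
proof (cases "n = 0")
  case True
  then show ?thesis by (simp add: log_wealth_0)
next
  case False
  obtain K where K: "\<And>n \<omega>. \<omega> \<in> space M \<Longrightarrow> (\<Sum>i<n. min_log (R i \<omega>) - K) \<le> X n \<omega>"
    using log_wealth_ge_sum_min_log by blast
  show ?thesis
  proof (rule Bochner_Integration.integrable_bound)
    let ?B = "\<lambda>\<omega>. \<Sum>i<n. exp ((real n * \<gamma>) * min_log (R i \<omega>)) * exp (- (real n * \<gamma> * K))"
    show "integrable M ?B"
      using False \<gamma> by (intro Bochner_Integration.integrable_sum integrable_mult_left integrable_exp_min_log)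
        (auto simp: mult_pos_neg)
    show "(\<lambda>\<omega>. exp (\<gamma> * X n \<omega>)) \<in> borel_measurable M"
      by (intro borel_measurable_exp_comp borel_measurable_times borel_measurable_const info_M[OF log_wealth_info])
    show "AE \<omega> in M. norm (exp (\<gamma> * X n \<omega>)) \<le> norm (?B \<omega>)"
    proof (rule AE_I2)
      fix \<omega> assume \<omega>: "\<omega> \<in> space M"
      have "\<gamma> * X n \<omega> \<le> \<gamma> * (\<Sum>i<n. min_log (R i \<omega>) - K)"
        using \<gamma> K[OF \<omega>] by (intro mult_left_mono_neg) auto
      then have "exp (\<gamma> * X n \<omega>) \<le> exp (\<Sum>i<n. \<gamma> * (min_log (R i \<omega>) - K))"
        by (simp add: sum_distrib_left)
      also have "\<dots> \<le> (\<Sum>i<n. exp (real n * (\<gamma> * (min_log (R i \<omega>) - K))))"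
        using False by (intro exp_sum_le_sum_exp) auto
      also have "\<dots> = ?B \<omega>"
        by (simp add: algebra_simps flip: exp_add)
      finally show "norm (exp (\<gamma> * X n \<omega>)) \<le> norm (?B \<omega>)"
        by simp
    qed
  qed
qed

lemma integrable_log_wealth: "integrable M (X n)"
proof (rule Bochner_Integration.integrable_bound)
  show "integrable M (\<lambda>\<omega>. exp (- 1 * X n \<omega>) + (\<Sum>i<n. \<bar>max_log (R i \<omega>)\<bar>))"
    using integrable_exp_log_wealth[of "-1"]
    by (intro Bochner_Integration.integrable_add Bochner_Integration.integrable_sum
        integrable_abs integrable_max_log) auto
  show "X n \<in> borel_measurable M" by (rule info_M[OF log_wealth_info])
  show "AE \<omega> in M. norm (X n \<omega>) \<le> norm (exp (- 1 * X n \<omega>) + (\<Sum>i<n. \<bar>max_log (R i \<omega>)\<bar>))"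
  proof (rule AE_I2)
    fix \<omega> assume \<omega>: "\<omega> \<in> space M"
    have "X n \<omega> \<le> (\<Sum>i<n. \<bar>max_log (R i \<omega>)\<bar>)"
      by (rule order_trans[OF log_wealth_le_sum_max_log[OF \<omega>]]) (auto intro: sum_mono)
    moreover have "0 \<le> (\<Sum>i<n. \<bar>max_log (R i \<omega>)\<bar>)" by (auto intro: sum_nonneg)
    moreover have "- X n \<omega> \<le> exp (- 1 * X n \<omega>)" "0 < exp (- 1 * X n \<omega>)"
      using exp_ge_add_one_self[of "- X n \<omega>"] by simp_all
    ultimately show "norm (X n \<omega>) \<le> norm (exp (- 1 * X n \<omega>) + (\<Sum>i<n. \<bar>max_log (R i \<omega>)\<bar>))"
      unfolding real_norm_def by linarith
  qed
qed

lemma expectation_log_wealth_le: "(\<integral>\<omega>. X n \<omega> \<partial>M) \<le> real n * (\<integral>\<omega>. max_log (R 0 \<omega>) \<partial>M)"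
proof -
  have "(\<integral>\<omega>. X n \<omega> \<partial>M) \<le> (\<integral>\<omega>. (\<Sum>i<n. max_log (R i \<omega>)) \<partial>M)"
    by (intro integral_mono integrable_log_wealth Bochner_Integration.integrable_sum integrable_max_log(1) log_wealth_le_sum_max_log) auto
  also have "\<dots> = (\<Sum>i<n. \<integral>\<omega>. max_log (R i \<omega>) \<partial>M)"
    by (intro Bochner_Integration.integral_sum integrable_max_log(1))
  also have "\<dots> = (\<Sum>i<n. \<integral>\<omega>. max_log (R 0 \<omega>) \<partial>M)"
    by (intro sum.cong refl integrable_max_log(2))
  finally show ?thesis by simp
qed


section \<open>Verification for negative risk parameters\<close>

text \<open>
  The tower property at time \<open>n\<close>: the period starting there contributes, given the information, its
  entropic utility at the weight just chosen.
\<close>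

lemma exp_wealth_step:
  assumes u: "u \<in> borel_measurable borel"
    and B: "\<And>p. p \<in> weight_simplex \<Longrightarrow> \<bar>u p\<bar> \<le> B" and \<gamma>: "\<gamma> < 0"
  shows "(\<integral>\<^sup>+\<omega>. ennreal (exp (\<gamma> * (X (Suc n) \<omega> + u (pre (Suc n) \<omega>)))) \<partial>M) =
    (\<integral>\<^sup>+\<omega>. ennreal (exp (\<gamma> * (X n \<omega> + s n \<omega> + entropic_utility M \<gamma> (period_payoff u (w n \<omega>))))) \<partial>M)"
proof -
  let ?f = "\<lambda>p. ennreal (exp (\<gamma> * (X n (fst p) + s n (fst p) +
      (ln (w n (fst p) \<bullet> snd p) + u (drift (w n (fst p)) (snd p))))))"
  note fst = measurable_compose[OF measurable_fst]
  have f: "?f \<in> borel_measurable (\<G> n \<Otimes>\<^sub>M borel)"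
    by (intro measurable_compose[OF _ measurable_ennreal] borel_measurable_exp_comp borel_measurable_times
        borel_measurable_const borel_measurable_add borel_measurable_ln borel_measurable_inner
        measurable_compose[OF _ u] borel_measurable_drift fst[OF log_wealth_info] fst[OF log_cost_info] fst[OF weight_info]
        measurable_snd)
  have "(\<integral>\<^sup>+\<omega>. ennreal (exp (\<gamma> * (X (Suc n) \<omega> + u (pre (Suc n) \<omega>)))) \<partial>M) = (\<integral>\<^sup>+\<omega>. ?f (\<omega>, R n \<omega>) \<partial>M)"
    unfolding log_wealth_Suc pre_weight_Suc by (simp add: add.assoc)
  also have "\<dots> = (\<integral>\<^sup>+\<omega>. \<integral>\<^sup>+\<omega>'. ?f (\<omega>, R 0 \<omega>') \<partial>M \<partial>M)"
    by (rule nn_integral_next_return[OF f])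
  also have "\<dots> = (\<integral>\<^sup>+\<omega>. ennreal (exp (\<gamma> * (X n \<omega> + s n \<omega> + entropic_utility M \<gamma> (period_payoff u (w n \<omega>))))) \<partial>M)"
  proof (rule nn_integral_cong)
    fix \<omega> assume \<omega>: "\<omega> \<in> space M"
    let ?A = "X n \<omega> + s n \<omega>"
    have i: "integrable M (\<lambda>\<omega>'. exp (\<gamma> * period_payoff u (w n \<omega>) \<omega>'))"
      by (rule integrable_exp_period_payoff[OF weight_in_simplex[OF \<omega>] u B \<gamma>])
    have "(\<integral>\<^sup>+\<omega>'. ?f (\<omega>, R 0 \<omega>') \<partial>M) =
        (\<integral>\<^sup>+\<omega>'. ennreal (exp (\<gamma> * ?A)) * ennreal (exp (\<gamma> * period_payoff u (w n \<omega>) \<omega>')) \<partial>M)"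
      by (simp add: period_payoff_def algebra_simps flip: ennreal_mult' exp_add)
    also have "\<dots> = ennreal (exp (\<gamma> * ?A)) * (\<integral>\<^sup>+\<omega>'. ennreal (exp (\<gamma> * period_payoff u (w n \<omega>) \<omega>')) \<partial>M)"
      by (rule nn_integral_cmult) (use borel_measurable_integrable[OF i] in measurable)
    also have "\<dots> = ennreal (exp (\<gamma> * (?A + entropic_utility M \<gamma> (period_payoff u (w n \<omega>)))))"
      using \<gamma> by (simp add: nn_integral_exp_entropic[OF i] algebra_simps flip: ennreal_mult' exp_add)
    finally show "(\<integral>\<^sup>+\<omega>'. ?f (\<omega>, R 0 \<omega>') \<partial>M) =
        ennreal (exp (\<gamma> * (?A + entropic_utility M \<gamma> (period_payoff u (w n \<omega>)))))" .
  qed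
  finally show ?thesis .
qed

lemma exp_wealth_cmult:
  assumes u: "u \<in> borel_measurable borel"
  shows "(\<integral>\<^sup>+\<omega>. ennreal (exp (\<gamma> * (X n \<omega> + u (pre n \<omega>) + a))) \<partial>M) =
    ennreal (exp (\<gamma> * a)) * (\<integral>\<^sup>+\<omega>. ennreal (exp (\<gamma> * (X n \<omega> + u (pre n \<omega>)))) \<partial>M)"
proof -
  have "(\<lambda>\<omega>. ennreal (exp (\<gamma> * (X n \<omega> + u (pre n \<omega>))))) \<in> borel_measurable M"
    by (intro measurable_compose[OF _ measurable_ennreal] borel_measurable_exp_comp borel_measurable_times
        borel_measurable_const borel_measurable_add info_M[OF log_wealth_info] measurable_compose[OF _ u] info_M[OF pre_weight_info])
  then have "ennreal (exp (\<gamma> * a)) * (\<integral>\<^sup>+\<omega>. ennreal (exp (\<gamma> * (X n \<omega> + u (pre n \<omega>)))) \<partial>M) =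
      (\<integral>\<^sup>+\<omega>. ennreal (exp (\<gamma> * a)) * ennreal (exp (\<gamma> * (X n \<omega> + u (pre n \<omega>)))) \<partial>M)"
    by (rule nn_integral_cmult[symmetric])
  also have "\<dots> = (\<integral>\<^sup>+\<omega>. ennreal (exp (\<gamma> * (X n \<omega> + u (pre n \<omega>) + a))) \<partial>M)"
    by (simp add: algebra_simps flip: ennreal_mult' exp_add)
  finally show ?thesis by simp
qed

text \<open>
  A supersolution \<open>u\<close> of the Bellman equation bounds every strategy. Since \<open>\<gamma> < 0\<close>, the inequality
  reverses inside the exponential, and the expectation of \<open>exp (\<gamma> * (X n + u (pre n)))\<close> is multiplied by
  at least \<open>exp (\<gamma> * b)\<close> in every period. Removing \<open>u\<close> at the two ends costs its oscillation \<open>K\<close>.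
\<close>

lemma entropic_wealth_le:
  assumes u: "u \<in> borel_measurable borel"
    and B: "\<And>p. p \<in> weight_simplex \<Longrightarrow> \<bar>u p\<bar> \<le> B" and \<gamma>: "\<gamma> < 0"
    and K: "\<And>p q. p \<in> weight_simplex \<Longrightarrow> q \<in> weight_simplex \<Longrightarrow> \<bar>u p - u q\<bar> \<le> K"
    and sup: "\<And>p q. p \<in> weight_simplex \<Longrightarrow> q \<in> weight_simplex \<Longrightarrow>
      ln (wealth_ratio c h p q) + entropic_utility M \<gamma> (period_payoff u q) \<le> u p + b"
  shows "entropic_utility M \<gamma> (X n) \<le> real n * b + K"
proof -
  let ?I = "\<lambda>n. \<integral>\<^sup>+\<omega>. ennreal (exp (\<gamma> * (X n \<omega> + u (pre n \<omega>)))) \<partial>M"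
  have "ennreal (exp (\<gamma> * (u \<pi> + real n * b))) \<le> ?I n"
  proof (induction n)
    case 0
    then show ?case by (simp add: log_wealth_0 emeasure_space_1)
  next
    case (Suc n)
    have "ennreal (exp (\<gamma> * (u \<pi> + real (Suc n) * b))) =
        ennreal (exp (\<gamma> * b)) * ennreal (exp (\<gamma> * (u \<pi> + real n * b)))"
      by (simp add: algebra_simps flip: ennreal_mult' exp_add)
    also have "\<dots> \<le> ennreal (exp (\<gamma> * b)) * ?I n"
      by (intro mult_left_mono Suc) simp
    also have "\<dots> = (\<integral>\<^sup>+\<omega>. ennreal (exp (\<gamma> * (X n \<omega> + u (pre n \<omega>) + b))) \<partial>M)"
      by (rule exp_wealth_cmult[OF u, symmetric])
    also have "\<dots> \<le> (\<integral>\<^sup>+\<omega>. ennreal (exp (\<gamma> * (X n \<omega> + s n \<omega> + entropic_utility M \<gamma> (period_payoff u (w n \<omega>))))) \<partial>M)"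
    proof (rule nn_integral_mono)
      fix \<omega> assume \<omega>: "\<omega> \<in> space M"
      have "X n \<omega> + s n \<omega> + entropic_utility M \<gamma> (period_payoff u (w n \<omega>)) \<le> X n \<omega> + u (pre n \<omega>) + b"
        using sup[OF pre_weight_in_simplex weight_in_simplex, OF \<omega> \<omega>, of n n] by simp
      then have "\<gamma> * (X n \<omega> + u (pre n \<omega>) + b) \<le> \<gamma> * (X n \<omega> + s n \<omega> + entropic_utility M \<gamma> (period_payoff u (w n \<omega>)))"
        using \<gamma> by (intro mult_left_mono_neg) auto
      then show "ennreal (exp (\<gamma> * (X n \<omega> + u (pre n \<omega>) + b))) \<le>
          ennreal (exp (\<gamma> * (X n \<omega> + s n \<omega> + entropic_utility M \<gamma> (period_payoff u (w n \<omega>)))))"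
        by (intro ennreal_leI) simp
    qed
    also have "\<dots> = ?I (Suc n)"
      by (rule exp_wealth_step[OF u B \<gamma>, symmetric])
    finally show ?case .
  qed
  also have "?I n \<le> (\<integral>\<^sup>+\<omega>. ennreal (exp (\<gamma> * (X n \<omega> + 0 + (u \<pi> - K)))) \<partial>M)"
  proof (rule nn_integral_mono)
    fix \<omega> assume \<omega>: "\<omega> \<in> space M"
    have "\<gamma> * (X n \<omega> + u (pre n \<omega>)) \<le> \<gamma> * (X n \<omega> + 0 + (u \<pi> - K))"
      using \<gamma> K[OF initial pre_weight_in_simplex[OF \<omega>, of n]] by (intro mult_left_mono_neg) auto
    then show "ennreal (exp (\<gamma> * (X n \<omega> + u (pre n \<omega>)))) \<le> ennreal (exp (\<gamma> * (X n \<omega> + 0 + (u \<pi> - K))))"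
      by (intro ennreal_leI) simp
  qed
  also have "\<dots> = ennreal (exp (\<gamma> * (u \<pi> - K))) * ennreal (exp (\<gamma> * entropic_utility M \<gamma> (X n)))"
    using exp_wealth_cmult[of "\<lambda>_. 0" \<gamma> n "u \<pi> - K"] nn_integral_exp_entropic[OF integrable_exp_log_wealth[OF \<gamma>, of n]] \<gamma>
    by simp
  finally have "exp (\<gamma> * (u \<pi> + real n * b)) \<le> exp (\<gamma> * (u \<pi> - K + entropic_utility M \<gamma> (X n)))"
    by (simp add: distrib_left flip: ennreal_mult' exp_add)
  then show ?thesis
    using \<gamma> by simp
qed

text \<open>
  The reverse of \<open>entropic_wealth_le\<close> for a strategy whose choices attain the Bellman supremum up
  to the error contained in \<open>b\<close>.
\<close>

lemma entropic_wealth_ge: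
  assumes u: "u \<in> borel_measurable borel"
    and B: "\<And>p. p \<in> weight_simplex \<Longrightarrow> \<bar>u p\<bar> \<le> B" and \<gamma>: "\<gamma> < 0"
    and K: "\<And>p q. p \<in> weight_simplex \<Longrightarrow> q \<in> weight_simplex \<Longrightarrow> \<bar>u p - u q\<bar> \<le> K"
    and opt: "\<And>n \<omega>. \<omega> \<in> space M \<Longrightarrow>
      u (pre n \<omega>) + b \<le> s n \<omega> + entropic_utility M \<gamma> (period_payoff u (w n \<omega>))"
  shows "real n * b - K \<le> entropic_utility M \<gamma> (X n)"
proof -
  let ?I = "\<lambda>n. \<integral>\<^sup>+\<omega>. ennreal (exp (\<gamma> * (X n \<omega> + u (pre n \<omega>)))) \<partial>M"
  have "ennreal (exp (\<gamma> * (u \<pi> + K))) * ennreal (exp (\<gamma> * entropic_utility M \<gamma> (X n))) =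
      (\<integral>\<^sup>+\<omega>. ennreal (exp (\<gamma> * (X n \<omega> + 0 + (u \<pi> + K)))) \<partial>M)"
    using exp_wealth_cmult[of "\<lambda>_. 0" \<gamma> n "u \<pi> + K"] nn_integral_exp_entropic[OF integrable_exp_log_wealth[OF \<gamma>, of n]] \<gamma>
    by simp
  also have "\<dots> \<le> ?I n"
  proof (rule nn_integral_mono)
    fix \<omega> assume \<omega>: "\<omega> \<in> space M"
    have "\<gamma> * (X n \<omega> + 0 + (u \<pi> + K)) \<le> \<gamma> * (X n \<omega> + u (pre n \<omega>))"
      using \<gamma> K[OF initial pre_weight_in_simplex[OF \<omega>, of n]] by (intro mult_left_mono_neg) auto
    then show "ennreal (exp (\<gamma> * (X n \<omega> + 0 + (u \<pi> + K)))) \<le> ennreal (exp (\<gamma> * (X n \<omega> + u (pre n \<omega>))))"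
      by (intro ennreal_leI) simp
  qed
  also have "?I n \<le> ennreal (exp (\<gamma> * (u \<pi> + real n * b)))"
  proof (induction n)
    case 0
    then show ?case by (simp add: log_wealth_0 emeasure_space_1)
  next
    case (Suc n)
    have "?I (Suc n) = (\<integral>\<^sup>+\<omega>. ennreal (exp (\<gamma> * (X n \<omega> + s n \<omega> + entropic_utility M \<gamma> (period_payoff u (w n \<omega>))))) \<partial>M)"
      by (rule exp_wealth_step[OF u B \<gamma>])
    also have "\<dots> \<le> (\<integral>\<^sup>+\<omega>. ennreal (exp (\<gamma> * (X n \<omega> + u (pre n \<omega>) + b))) \<partial>M)"
    proof (rule nn_integral_mono)
      fix \<omega> assume \<omega>: "\<omega> \<in> space M"
      have "\<gamma> * (X n \<omega> + s n \<omega> + entropic_utility M \<gamma> (period_payoff u (w n \<omega>))) \<le> \<gamma> * (X n \<omega> + u (pre n \<omega>) + b)"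
        using \<gamma> opt[OF \<omega>, of n] by (intro mult_left_mono_neg) auto
      then show "ennreal (exp (\<gamma> * (X n \<omega> + s n \<omega> + entropic_utility M \<gamma> (period_payoff u (w n \<omega>))))) \<le>
          ennreal (exp (\<gamma> * (X n \<omega> + u (pre n \<omega>) + b)))"
        by (intro ennreal_leI) simp
    qed
    also have "\<dots> = ennreal (exp (\<gamma> * b)) * ?I n"
      by (rule exp_wealth_cmult[OF u])
    also have "\<dots> \<le> ennreal (exp (\<gamma> * b)) * ennreal (exp (\<gamma> * (u \<pi> + real n * b)))"
      by (intro mult_left_mono Suc) simp
    also have "\<dots> = ennreal (exp (\<gamma> * (u \<pi> + real (Suc n) * b)))"
      by (simp add: algebra_simps flip: ennreal_mult' exp_add)
    finally show ?case .
  qed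
  finally have "exp (\<gamma> * (u \<pi> + K + entropic_utility M \<gamma> (X n))) \<le> exp (\<gamma> * (u \<pi> + real n * b))"
    by (simp add: distrib_left flip: ennreal_mult' exp_add)
  then show ?thesis
    using \<gamma> by simp
qed

end

lemma liminf_growth_le:
  fixes a :: "nat \<Rightarrow> real"
  assumes "0 < m" "\<And>n. a n \<le> real n * b + K"
  shows "liminf (\<lambda>n. ereal (1 / (real n * m) * a n)) \<le> ereal (b / m)"
proof -
  have "(\<lambda>n. b / m + (K / m) * (1 / real n)) \<longlonglongrightarrow> b / m + (K / m) * 0"
    by (intro tendsto_intros lim_1_over_n)
  then have lim: "(\<lambda>n. ereal (b / m + (K / m) * (1 / real n))) \<longlonglongrightarrow> ereal (b / m)"
    by (simp add: lim_ereal)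
  have "liminf (\<lambda>n. ereal (1 / (real n * m) * a n)) \<le> liminf (\<lambda>n. ereal (b / m + (K / m) * (1 / real n)))"
  proof (intro Liminf_mono eventually_mono[OF eventually_gt_at_top[of 0]])
    fix n :: nat assume n: "0 < n"
    have "1 / (real n * m) * a n \<le> 1 / (real n * m) * (real n * b + K)"
      using assms n by (intro mult_left_mono) auto
    also have "\<dots> = b / m + (K / m) * (1 / real n)"
      using assms(1) n by (simp add: field_simps)
    finally show "ereal (1 / (real n * m) * a n) \<le> ereal (b / m + (K / m) * (1 / real n))" by simp
  qed
  also have "\<dots> = ereal (b / m)"
    using lim by (intro lim_imp_Liminf) auto
  finally show ?thesis .
qed

lemma liminf_growth_ge:
  fixes a :: "nat \<Rightarrow> real"
  assumes "0 < m" "\<And>n. real n * b - K \<le> a n"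
  shows "ereal (b / m) \<le> liminf (\<lambda>n. ereal (1 / (real n * m) * a n))"
proof -
  have "(\<lambda>n. b / m - (K / m) * (1 / real n)) \<longlonglongrightarrow> b / m - (K / m) * 0"
    by (intro tendsto_intros lim_1_over_n)
  then have lim: "(\<lambda>n. ereal (b / m - (K / m) * (1 / real n))) \<longlonglongrightarrow> ereal (b / m)"
    by (simp add: lim_ereal)
  then have "ereal (b / m) = liminf (\<lambda>n. ereal (b / m - (K / m) * (1 / real n)))"
    by (intro lim_imp_Liminf[symmetric]) auto
  also have "\<dots> \<le> liminf (\<lambda>n. ereal (1 / (real n * m) * a n))"
  proof (intro Liminf_mono eventually_mono[OF eventually_gt_at_top[of 0]])
    fix n :: nat assume n: "0 < n"
    have "b / m - (K / m) * (1 / real n) = 1 / (real n * m) * (real n * b - K)"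
      using assms(1) n by (simp add: field_simps)
    also have "\<dots> \<le> 1 / (real n * m) * a n"
      using assms n by (intro mult_left_mono) auto
    finally show "ereal (b / m - (K / m) * (1 / real n)) \<le> ereal (1 / (real n * m) * a n)" by simp
  qed
  finally show ?thesis .
qed

context rebalancing_market
begin

lemma jump_time_strict_mono:
  assumes "\<omega> \<in> space M"
  shows "strict_mono (\<lambda>n. \<tau> n \<omega>)"
  by (simp add: strict_mono_Suc_iff jump_time_Suc waiting_pos[OF assms])

primrec feedback_pre :: "(real^'d \<Rightarrow> real^'d) \<Rightarrow> real^'d \<Rightarrow> nat \<Rightarrow> 'a \<Rightarrow> real^'d" where
  "feedback_pre \<sigma> \<pi> 0 \<omega> = \<pi>"
| "feedback_pre \<sigma> \<pi> (Suc n) \<omega> = drift (\<sigma> (feedback_pre \<sigma> \<pi> n \<omega>)) (R n \<omega>)"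

lemma feedback_pre_info:
  assumes \<sigma>: "\<sigma> \<in> borel_measurable borel"
  shows "feedback_pre \<sigma> \<pi> n \<in> borel_measurable (\<G> n)"
proof (induction n)
  case 0
  have "feedback_pre \<sigma> \<pi> 0 = (\<lambda>_. \<pi>)" by (rule ext) simp
  then show ?case by simp
next
  case (Suc n)
  have eq: "feedback_pre \<sigma> \<pi> (Suc n) = (\<lambda>\<omega>. drift (\<sigma> (feedback_pre \<sigma> \<pi> n \<omega>)) (R n \<omega>))"
    by (rule ext) simp
  show ?case
    unfolding eq by (intro borel_measurable_drift measurable_compose[OF _ \<sigma>] info_Suc[OF Suc] R_info)
qed

text \<open>
  Holding the weights \<open>\<sigma> (pre n)\<close> at every rebalancing is an admissible strategy: on the period
  containing \<open>t\<close> the weights drift from the last choice, and beyond an accumulation point of the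
  rebalancing times they are set to the uniform weight.
\<close>

lemma feedback_strategy:
  assumes \<sigma>: "\<sigma> \<in> borel_measurable borel" "\<And>p. \<sigma> p \<in> weight_simplex"
  obtains W where "W \<in> strategies M S \<eta> \<G> \<pi>"
    "\<And>n \<omega>. \<omega> \<in> space M \<Longrightarrow> W (\<tau> n \<omega>) \<omega> = \<sigma> (pre_weight S \<eta> W \<pi> n \<omega>)"
proof -
  let ?f = "feedback_pre \<sigma> \<pi>"
  define current where "current t \<omega> n \<longleftrightarrow> \<tau> n \<omega> \<le> t \<and> t < \<tau> (Suc n) \<omega>" for t \<omega> n
  define W where "W t \<omega> =
    (if t < 0 then \<pi>
     else if \<exists>n. current t \<omega> n
       then drift (\<sigma> (?f (THE n. current t \<omega> n) \<omega>)) (price_ratio S (\<tau> (THE n. current t \<omega> n) \<omega>) t \<omega>)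
     else (\<chi> i. 1 / real CARD('d)))" for t \<omega>
  have unique: "(THE n. current t \<omega> n) = n" if \<omega>: "\<omega> \<in> space M" and n: "current t \<omega> n" for t \<omega> n
  proof (rule the_equality)
    show "current t \<omega> n" by (rule n)
    fix k assume k: "current t \<omega> k"
    have "\<tau> n \<omega> < \<tau> (Suc k) \<omega>" "\<tau> k \<omega> < \<tau> (Suc n) \<omega>"
      using n k by (auto simp: current_def)
    then show "k = n"
      using strict_mono_less[OF jump_time_strict_mono[OF \<omega>]] by (meson less_Suc_eq_le order_antisym)
  qed
  have W: "W t \<omega> = drift (\<sigma> (?f n \<omega>)) (price_ratio S (\<tau> n \<omega>) t \<omega>)"
    if \<omega>: "\<omega> \<in> space M" and n: "current t \<omega> n" for t \<omega> n
  proof -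
    have "0 \<le> t" using n jump_time_nonneg[OF \<omega>, of n] by (simp add: current_def)
    then show ?thesis using n unique[OF \<omega> n] by (auto simp: W_def)
  qed
  have current: "current (\<tau> n \<omega>) \<omega> n" if "\<omega> \<in> space M" for n \<omega>
    using waiting_pos[OF that] by (simp add: current_def jump_time_Suc)
  have Wn: "W (\<tau> n \<omega>) \<omega> = \<sigma> (?f n \<omega>)" if \<omega>: "\<omega> \<in> space M" for n \<omega>
  proof -
    have "price_ratio S (\<tau> n \<omega>) (\<tau> n \<omega>) \<omega> = 1"
      using price_pos[OF \<omega> jump_time_nonneg[OF \<omega>]]
      by (simp add: price_ratio_def vec_eq_iff less_imp_neq[symmetric])
    then show ?thesis
      using W[OF \<omega> current[OF \<omega>]] drift_one[OF \<sigma>(2)] by simp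
  qed
  show thesis
  proof (rule that[of W])
    fix n \<omega> assume \<omega>: "\<omega> \<in> space M"
    have "pre_weight S \<eta> W \<pi> n \<omega> = ?f n \<omega>"
      using \<omega> by (cases n) (simp_all add: Wn R_def)
    with Wn[OF \<omega>] show "W (\<tau> n \<omega>) \<omega> = \<sigma> (pre_weight S \<eta> W \<pi> n \<omega>)" by simp
  next
    have "W t \<omega> \<in> weight_simplex" if "\<omega> \<in> space M" "0 \<le> t" for t \<omega>
    proof (cases "\<exists>n. current t \<omega> n")
      case True
      then obtain n where "current t \<omega> n" ..
      with that show ?thesis
        by (auto simp: W intro!: drift_in_simplex \<sigma> price_ratio_pos jump_time_nonneg)
    next
      case False
      with that show ?thesis using uniform_weight[where 'd = 'd] by (auto simp: W_def)
    qed
    moreover have "(\<lambda>\<omega>. W (\<tau> n \<omega>) \<omega>) \<in> borel_measurable (\<G> n)" for n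
    proof -
      have "(\<lambda>\<omega>. \<sigma> (?f n \<omega>)) \<in> borel_measurable (\<G> n)"
        by (rule measurable_compose[OF feedback_pre_info[OF \<sigma>(1)] \<sigma>(1)])
      moreover have "(\<lambda>\<omega>. W (\<tau> n \<omega>) \<omega>) \<in> borel_measurable (\<G> n) \<longleftrightarrow>
          (\<lambda>\<omega>. \<sigma> (?f n \<omega>)) \<in> borel_measurable (\<G> n)"
        by (rule measurable_cong) (simp add: Wn)
      ultimately show ?thesis by simp
    qed
    moreover have "W t \<omega> = drift (W (\<tau> n \<omega>) \<omega>) (price_ratio S (\<tau> n \<omega>) t \<omega>)"
      if "\<omega> \<in> space M" "t \<in> {\<tau> n \<omega>..<\<tau> (Suc n) \<omega>}" for n t \<omega>
      using W[OF that(1), of t n] that by (simp add: Wn current_def)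
    moreover have "W t \<omega> = \<pi>" if "t < 0" for t \<omega>
      using that by (simp add: W_def)
    ultimately show "W \<in> strategies M S \<eta> \<G> \<pi>"
      unfolding strategies_def by blast
  qed
qed

text \<open>
  The equation split into its two halves, with \<open>v\<close> extended by \<open>0\<close> off the simplex to become Borel
  measurable on the whole space. The Lipschitz bound holds since the sum of the current cost and a
  term free of the current weight \<open>p\<close> is maximised, and a supremum of functions with a common
  Lipschitz constant has that constant as well; neither \<open>\<gamma>\<close> nor \<open>lam\<close> enters it.
\<close>

lemma bellman_solution_inequalities:
  assumes bell: "bellman_solution M S \<eta> c h \<gamma> v lam"
    and L: "\<And>p q p'. p \<in> weight_simplex \<Longrightarrow> q \<in> weight_simplex \<Longrightarrow> p' \<in> weight_simplex
      \<Longrightarrow> \<bar>ln (wealth_ratio c h p q) - ln (wealth_ratio c h p' q)\<bar> \<le> L * dist p p'"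
  obtains u B where "u \<in> borel_measurable borel" "\<And>p. p \<in> weight_simplex \<Longrightarrow> \<bar>u p\<bar> \<le> B"
    "\<And>p q. p \<in> weight_simplex \<Longrightarrow> q \<in> weight_simplex \<Longrightarrow>
      ln (wealth_ratio c h p q) + entropic_utility M \<gamma> (period_payoff u q) \<le> u p + lam * mean_wait"
    "\<And>p e. p \<in> weight_simplex \<Longrightarrow> 0 < e \<Longrightarrow> \<exists>q\<in>weight_simplex.
      u p + lam * mean_wait - e \<le> ln (wealth_ratio c h p q) + entropic_utility M \<gamma> (period_payoff u q)"
    "\<And>p p'. p \<in> weight_simplex \<Longrightarrow> p' \<in> weight_simplex \<Longrightarrow> \<bar>u p - u p'\<bar> \<le> L * dist p p'"
proof -
  define u where "u = (\<lambda>p. if p \<in> weight_simplex then v p else 0)"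
  define F where "F p q = ln (wealth_ratio c h p q) + entropic_utility M \<gamma> (period_payoff u q)" for p q
  have meas: "u \<in> borel_measurable borel"
    unfolding u_def using bell
    by (intro borel_measurable_continuous_on_if) (auto simp: bellman_solution_def borel_closed closed_weight_simplex)
  have "bounded (v ` weight_simplex)"
    using bell by (simp add: bellman_solution_def)
  then obtain B where B: "\<And>p. p \<in> weight_simplex \<Longrightarrow> \<bar>u p\<bar> \<le> B"
    by (auto simp: bounded_iff u_def)
  have eu: "entropic_utility M \<gamma> (\<lambda>\<omega>. ln (q \<bullet> price_ratio S 0 (\<eta> 1 \<omega>) \<omega>) + v (drift q (price_ratio S 0 (\<eta> 1 \<omega>) \<omega>)))
      = entropic_utility M \<gamma> (period_payoff u q)" if q: "q \<in> weight_simplex" for q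
  proof -
    have "ln (q \<bullet> price_ratio S 0 (\<eta> 1 \<omega>) \<omega>) + v (drift q (price_ratio S 0 (\<eta> 1 \<omega>) \<omega>)) = period_payoff u q \<omega>"
      if "\<omega> \<in> space M" for \<omega>
      using drift_R_in_simplex[OF that q, of 0] by (simp add: period_payoff_def u_def R_0)
    then show ?thesis
      unfolding entropic_utility_def by (simp cong: Bochner_Integration.integral_cong)
  qed
  have sup: "ereal (u p) = (SUP q\<in>weight_simplex. ereal (F p q - lam * mean_wait))" if p: "p \<in> weight_simplex" for p
  proof -
    have "ereal (v p) = (SUP q\<in>weight_simplex. ereal (ln (wealth_ratio c h p q) - lam * (\<integral>\<omega>. \<eta> 1 \<omega> \<partial>M) +
          entropic_utility M \<gamma> (\<lambda>\<omega>. ln (q \<bullet> price_ratio S 0 (\<eta> 1 \<omega>) \<omega>) +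
            v (drift q (price_ratio S 0 (\<eta> 1 \<omega>) \<omega>)))))"
      using bell p by (simp add: bellman_solution_def)
    also have "\<dots> = (SUP q\<in>weight_simplex. ereal (F p q - lam * mean_wait))"
      by (rule SUP_cong[OF refl]) (simp add: eu F_def mean_wait_def del: One_nat_def)
    finally show ?thesis using p by (simp add: u_def)
  qed
  have le: "F p q \<le> u p + lam * mean_wait" if "p \<in> weight_simplex" "q \<in> weight_simplex" for p q
  proof -
    have "ereal (F p q - lam * mean_wait) \<le> ereal (u p)"
      unfolding sup[OF that(1)] using that(2) by (rule SUP_upper)
    then show ?thesis by simp
  qed
  have opt: "\<exists>q\<in>weight_simplex. u p + lam * mean_wait - e \<le> F p q" if p: "p \<in> weight_simplex" and e: "0 < e" for p e
  proof -
    have "ereal (u p - e) < (SUP q\<in>weight_simplex. ereal (F p q - lam * mean_wait))"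
      unfolding sup[OF p, symmetric] using e by simp
    then obtain q where "q \<in> weight_simplex" "u p - e < F p q - lam * mean_wait"
      by (auto simp: less_SUP_iff)
    then show ?thesis by (intro bexI[of _ q]) auto
  qed
  have lip: "u p \<le> u p' + L * dist p p'" if p: "p \<in> weight_simplex" "p' \<in> weight_simplex" for p p'
  proof (rule field_le_epsilon)
    fix e :: real assume "0 < e"
    with opt[OF p(1)] obtain q where q: "q \<in> weight_simplex" "u p + lam * mean_wait - e \<le> F p q"
      by blast
    have "F p q \<le> F p' q + L * dist p p'"
      using L[OF p(1) q(1) p(2)] by (simp add: F_def)
    with q(2) le[OF p(2) q(1)] show "u p \<le> u p' + L * dist p p' + e" by simp
  qed
  show thesis
  proof (rule that[of u B])
    show "\<bar>u p - u p'\<bar> \<le> L * dist p p'" if "p \<in> weight_simplex" "p' \<in> weight_simplex" for p p'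
      using lip[OF that] lip[OF that(2,1)] by (simp add: dist_commute abs_le_iff)
  qed (use meas B le opt in \<open>auto simp: F_def\<close>)
qed

lemma growth_functional_eq:
  "growth_functional M S \<eta> c h \<gamma> W \<pi> =
    liminf (\<lambda>n. ereal (1 / (real n * mean_wait) * entropic_utility M \<gamma> (log_wealth S \<eta> c h W \<pi> n)))"
  by (simp add: growth_functional_def expectation_jump_time)

lemma ln_wealth_ratio_lipschitz_first:
  obtains L where "0 < L" "\<And>p q p'. p \<in> weight_simplex \<Longrightarrow> q \<in> weight_simplex \<Longrightarrow> p' \<in> weight_simplex
      \<Longrightarrow> \<bar>ln (wealth_ratio c h p q) - ln (wealth_ratio c h p' q)\<bar> \<le> L * dist p p'"
proof -
  obtain L where "0 < L"
    "\<And>p q p' q'. p \<in> weight_simplex \<Longrightarrow> q \<in> weight_simplex \<Longrightarrow> p' \<in> weight_simplex \<Longrightarrow> q' \<in> weight_simplex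
      \<Longrightarrow> \<bar>ln (wealth_ratio c h p q) - ln (wealth_ratio c h p' q')\<bar> \<le> L * (dist p p' + dist q q')"
    using ln_wealth_ratio_lipschitz[OF costs] by blast
  from this(1) this(2)[of _ q _ q for q] show thesis
    by (intro that[of L]) auto
qed

text \<open>
  The constant \<open>K\<close> is chosen before \<open>\<gamma>\<close> and the solution: it is the common Lipschitz constant times
  the diameter bound \<open>2\<close> of the simplex. This uniformity carries the passage to \<open>\<gamma> = 0\<close>.
\<close>

lemma entropic_wealth_uniform_bound:
  obtains K where "\<And>\<gamma> v lam \<pi> W n. \<gamma> < 0 \<Longrightarrow> bellman_solution M S \<eta> c h \<gamma> v lam \<Longrightarrow> \<pi> \<in> weight_simplex \<Longrightarrow>
    W \<in> strategies M S \<eta> \<G> \<pi> \<Longrightarrow>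
    entropic_utility M \<gamma> (log_wealth S \<eta> c h W \<pi> n) \<le> real n * (lam * mean_wait) + K"
proof -
  obtain L where L: "0 < L" "\<And>p q p'. p \<in> weight_simplex \<Longrightarrow> q \<in> weight_simplex \<Longrightarrow> p' \<in> weight_simplex
      \<Longrightarrow> \<bar>ln (wealth_ratio c h p q) - ln (wealth_ratio c h p' q)\<bar> \<le> L * dist p p'"
    using ln_wealth_ratio_lipschitz_first by blast
  show thesis
  proof (rule that[of "L * 2"])
    fix \<gamma> v lam \<pi> W n
    assume \<gamma>: "\<gamma> < 0" and bell: "bellman_solution M S \<eta> c h \<gamma> v lam"
      and \<pi>: "\<pi> \<in> weight_simplex" and W: "W \<in> strategies M S \<eta> \<G> \<pi>"
    interpret rebalanced_portfolio M S \<eta> \<G> c h \<pi> W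
      by unfold_locales (fact \<pi> W)+
    obtain u B where u: "u \<in> borel_measurable borel" "\<And>p. p \<in> weight_simplex \<Longrightarrow> \<bar>u p\<bar> \<le> B"
      "\<And>p q. p \<in> weight_simplex \<Longrightarrow> q \<in> weight_simplex \<Longrightarrow>
        ln (wealth_ratio c h p q) + entropic_utility M \<gamma> (period_payoff u q) \<le> u p + lam * mean_wait"
      "\<And>p p'. p \<in> weight_simplex \<Longrightarrow> p' \<in> weight_simplex \<Longrightarrow> \<bar>u p - u p'\<bar> \<le> L * dist p p'"
      by (rule bellman_solution_inequalities[OF bell L(2)]) blast+
    show "entropic_utility M \<gamma> (log_wealth S \<eta> c h W \<pi> n) \<le> real n * (lam * mean_wait) + L * 2"
    proof (rule entropic_wealth_le[OF u(1,2) \<gamma> _ u(3)])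
      show "\<bar>u p - u q\<bar> \<le> L * 2" if "p \<in> weight_simplex" "q \<in> weight_simplex" for p q
        by (rule order_trans[OF u(4)[OF that] mult_left_mono[OF weight_simplex_dist_le_2[OF that]]])
          (use L(1) in simp)
    qed auto
  qed
qed

lemma near_optimal_strategy:
  assumes \<gamma>: "\<gamma> < 0" and bell: "bellman_solution M S \<eta> c h \<gamma> v lam"
    and \<pi>: "\<pi> \<in> weight_simplex" and e: "0 < e"
  obtains W where "W \<in> strategies M S \<eta> \<G> \<pi>" "ereal (lam - e) \<le> growth_functional M S \<eta> c h \<gamma> W \<pi>"
proof -
  obtain L where L: "0 < L" "\<And>p q p'. p \<in> weight_simplex \<Longrightarrow> q \<in> weight_simplex \<Longrightarrow> p' \<in> weight_simplex
      \<Longrightarrow> \<bar>ln (wealth_ratio c h p q) - ln (wealth_ratio c h p' q)\<bar> \<le> L * dist p p'"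
    using ln_wealth_ratio_lipschitz_first by blast
  obtain u B where u: "u \<in> borel_measurable borel" "\<And>p. p \<in> weight_simplex \<Longrightarrow> \<bar>u p\<bar> \<le> B"
    and opt: "\<And>p e. p \<in> weight_simplex \<Longrightarrow> 0 < e \<Longrightarrow> \<exists>q\<in>weight_simplex.
      u p + lam * mean_wait - e \<le> ln (wealth_ratio c h p q) + entropic_utility M \<gamma> (period_payoff u q)"
    and lip: "\<And>p p'. p \<in> weight_simplex \<Longrightarrow> p' \<in> weight_simplex \<Longrightarrow> \<bar>u p - u p'\<bar> \<le> L * dist p p'"
    by (rule bellman_solution_inequalities[OF bell L(2)]) blast+
  \<comment> \<open>An error of \<open>e * mean_wait\<close> per period is an error of \<open>e\<close> per unit of time.\<close>
  have \<epsilon>: "0 < e * mean_wait" using e mean_wait_pos by simp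
  obtain \<sigma> where \<sigma>: "\<sigma> \<in> borel_measurable borel" "\<And>p. \<sigma> p \<in> weight_simplex"
    "\<And>p. p \<in> weight_simplex \<Longrightarrow> u p + lam * mean_wait - e * mean_wait
      \<le> ln (wealth_ratio c h p (\<sigma> p)) + entropic_utility M \<gamma> (period_payoff u (\<sigma> p))"
  proof (rule measurable_near_optimal_selection[where A = weight_simplex and B = weight_simplex and L = L
        and F = "\<lambda>p q. ln (wealth_ratio c h p q) + entropic_utility M \<gamma> (period_payoff u q)"
        and u = "\<lambda>p. u p + lam * mean_wait" and \<epsilon> = "e * mean_wait"])
  qed (use L lip opt \<pi> \<epsilon> in auto)
  obtain W where W: "W \<in> strategies M S \<eta> \<G> \<pi>"
    "\<And>n \<omega>. \<omega> \<in> space M \<Longrightarrow> W (\<tau> n \<omega>) \<omega> = \<sigma> (pre_weight S \<eta> W \<pi> n \<omega>)"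
    using feedback_strategy[OF \<sigma>(1,2)] by blast
  interpret rebalanced_portfolio M S \<eta> \<G> c h \<pi> W
    by unfold_locales (fact \<pi> W)+
  have "real n * ((lam - e) * mean_wait) - L * 2 \<le> entropic_utility M \<gamma> (X n)" for n
  proof (rule entropic_wealth_ge[OF u \<gamma>])
    show "\<bar>u p - u q\<bar> \<le> L * 2" if "p \<in> weight_simplex" "q \<in> weight_simplex" for p q
      by (rule order_trans[OF lip[OF that] mult_left_mono[OF weight_simplex_dist_le_2[OF that]]])
        (use L(1) in simp)
    show "u (pre n \<omega>) + (lam - e) * mean_wait \<le> s n \<omega> + entropic_utility M \<gamma> (period_payoff u (w n \<omega>))"
      if "\<omega> \<in> space M" for n \<omega>
      using \<sigma>(3)[OF pre_weight_in_simplex[OF that, of n]] W(2)[OF that, of n] by (simp add: algebra_simps)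
  qed auto
  from liminf_growth_ge[OF mean_wait_pos this] have "ereal (lam - e) \<le> growth_functional M S \<eta> c h \<gamma> W \<pi>"
    using mean_wait_pos by (simp add: growth_functional_eq)
  with W(1) show thesis by (rule that)
qed

lemma entropic_value:
  assumes \<gamma>: "\<gamma> < 0" and bell: "bellman_solution M S \<eta> c h \<gamma> v lam" and \<pi>: "\<pi> \<in> weight_simplex"
  shows "(SUP W\<in>strategies M S \<eta> \<G> \<pi>. growth_functional M S \<eta> c h \<gamma> W \<pi>) = ereal lam"
proof (rule antisym)
  obtain K where K: "\<And>\<gamma> v lam \<pi> W n. \<gamma> < 0 \<Longrightarrow> bellman_solution M S \<eta> c h \<gamma> v lam \<Longrightarrow> \<pi> \<in> weight_simplex \<Longrightarrow>
    W \<in> strategies M S \<eta> \<G> \<pi> \<Longrightarrow>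
    entropic_utility M \<gamma> (log_wealth S \<eta> c h W \<pi> n) \<le> real n * (lam * mean_wait) + K"
    using entropic_wealth_uniform_bound by blast
  show "(SUP W\<in>strategies M S \<eta> \<G> \<pi>. growth_functional M S \<eta> c h \<gamma> W \<pi>) \<le> ereal lam"
  proof (rule SUP_least)
    fix W assume "W \<in> strategies M S \<eta> \<G> \<pi>"
    from liminf_growth_le[OF mean_wait_pos K[OF \<gamma> bell \<pi> this]]
    show "growth_functional M S \<eta> c h \<gamma> W \<pi> \<le> ereal lam"
      using mean_wait_pos by (simp add: growth_functional_eq)
  qed
  show "ereal lam \<le> (SUP W\<in>strategies M S \<eta> \<G> \<pi>. growth_functional M S \<eta> c h \<gamma> W \<pi>)"
  proof (rule ereal_le_epsilon2)
    fix e :: real assume "0 < e"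
    then obtain W where W: "W \<in> strategies M S \<eta> \<G> \<pi>"
      "ereal (lam - e) \<le> growth_functional M S \<eta> c h \<gamma> W \<pi>"
      using near_optimal_strategy[OF \<gamma> bell \<pi>] by blast
    have "growth_functional M S \<eta> c h \<gamma> W \<pi> \<le> (SUP W\<in>strategies M S \<eta> \<G> \<pi>. growth_functional M S \<eta> c h \<gamma> W \<pi>)"
      using W(1) by (rule SUP_upper)
    with W(2) have "ereal (lam - e) + ereal e \<le>
        (SUP W\<in>strategies M S \<eta> \<G> \<pi>. growth_functional M S \<eta> c h \<gamma> W \<pi>) + ereal e"
      by (intro add_right_mono) simp
    then show "ereal lam \<le> (SUP W\<in>strategies M S \<eta> \<G> \<pi>. growth_functional M S \<eta> c h \<gamma> W \<pi>) + ereal e"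
      by simp
  qed
qed

end


section \<open>The risk-neutral limit\<close>

context rebalancing_market
begin

lemma growth_functional_mono:
  assumes \<gamma>: "\<gamma> < 0" and \<pi>: "\<pi> \<in> weight_simplex" and W: "W \<in> strategies M S \<eta> \<G> \<pi>"
  shows "growth_functional M S \<eta> c h \<gamma> W \<pi> \<le> growth_functional M S \<eta> c h 0 W \<pi>"
proof -
  interpret rebalanced_portfolio M S \<eta> \<G> c h \<pi> W
    by unfold_locales (fact \<pi> W)+
  show ?thesis
    unfolding growth_functional_eq
  proof (intro Liminf_mono always_eventually allI)
    fix n
    have "entropic_utility M \<gamma> (X n) \<le> entropic_utility M 0 (X n)"
      by (rule entropic_le_expectation[OF integrable_log_wealth integrable_exp_log_wealth[OF \<gamma>] \<gamma>])
    then have "1 / (real n * mean_wait) * entropic_utility M \<gamma> (X n) \<le>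
        1 / (real n * mean_wait) * entropic_utility M 0 (X n)"
      using mean_wait_pos by (intro mult_left_mono) auto
    then show "ereal (1 / (real n * mean_wait) * entropic_utility M \<gamma> (X n)) \<le>
        ereal (1 / (real n * mean_wait) * entropic_utility M 0 (X n))" by simp
  qed
qed

text \<open>
  Rebalancing costs money and no portfolio beats the best asset of a period.
\<close>

lemma growth_functional_0_le:
  assumes \<pi>: "\<pi> \<in> weight_simplex" and W: "W \<in> strategies M S \<eta> \<G> \<pi>"
  shows "growth_functional M S \<eta> c h 0 W \<pi> \<le> ereal ((\<integral>\<omega>. max_log (R 0 \<omega>) \<partial>M) / mean_wait)"
proof -
  interpret rebalanced_portfolio M S \<eta> \<G> c h \<pi> W
    by unfold_locales (fact \<pi> W)+
  show ?thesis
    unfolding growth_functional_eq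
    by (rule liminf_growth_le[OF mean_wait_pos, where K = 0]) (use expectation_log_wealth_le in \<open>simp add: entropic_utility_def\<close>)
qed

text \<open>
  The number of periods \<open>n\<close> is fixed first, large enough for the uniform constant \<open>K\<close> to be absorbed
  by the gap between \<open>a\<close> and the growth rate; only then does \<open>\<gamma>\<close> tend to \<open>0\<close>.
\<close>

lemma eventually_bellman_constant_greater:
  fixes a :: real
  assumes bell: "\<And>\<gamma>. \<gamma> < 0 \<Longrightarrow> bellman_solution M S \<eta> c h \<gamma> (v \<gamma>) (lam \<gamma>)"
    and \<pi>: "\<pi> \<in> weight_simplex" and W: "W \<in> strategies M S \<eta> \<G> \<pi>"
    and a: "ereal a < growth_functional M S \<eta> c h 0 W \<pi>"
  shows "\<forall>\<^sub>F \<gamma> in at_left 0. a < lam \<gamma>"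
proof -
  interpret rebalanced_portfolio M S \<eta> \<G> c h \<pi> W
    by unfold_locales (fact \<pi> W)+
  obtain K where K: "\<And>\<gamma> v lam \<pi> W n. \<gamma> < 0 \<Longrightarrow> bellman_solution M S \<eta> c h \<gamma> v lam \<Longrightarrow> \<pi> \<in> weight_simplex \<Longrightarrow>
    W \<in> strategies M S \<eta> \<G> \<pi> \<Longrightarrow>
    entropic_utility M \<gamma> (log_wealth S \<eta> c h W \<pi> n) \<le> real n * (lam * mean_wait) + K"
    using entropic_wealth_uniform_bound by blast
  obtain a' where a': "a < a'" "ereal a' < growth_functional M S \<eta> c h 0 W \<pi>"
    using ereal_dense2[OF a] by auto
  have "\<forall>\<^sub>F n in sequentially. ereal a' < ereal (1 / (real n * mean_wait) * entropic_utility M 0 (X n))"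
    using a'(2) unfolding growth_functional_eq by (rule less_LiminfD)
  moreover have "\<forall>\<^sub>F n in sequentially. K / (mean_wait * (a' - a)) < real n"
    by (intro eventually_gt_at_top filterlim_real_sequentially[THEN filterlim_at_top_dense[THEN iffD1], rule_format])
  moreover have "\<forall>\<^sub>F n :: nat in sequentially. 0 < n"
    by (rule eventually_gt_at_top)
  ultimately have "\<forall>\<^sub>F n in sequentially. real n * (a * mean_wait) + K < (\<integral>\<omega>. X n \<omega> \<partial>M)"
  proof eventually_elim
    case (elim n)
    have nm: "0 < real n * mean_wait" using elim(3) mean_wait_pos by simp
    have "K < real n * (mean_wait * (a' - a))"
      using elim(2) mean_wait_pos a'(1) by (simp add: pos_divide_less_eq)
    moreover have "a' * (real n * mean_wait) < (\<integral>\<omega>. X n \<omega> \<partial>M)"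
      using elim(1) nm by (simp add: entropic_utility_def pos_less_divide_eq)
    ultimately show ?case by (simp add: algebra_simps)
  qed
  then obtain n where n: "real n * (a * mean_wait) + K < (\<integral>\<omega>. X n \<omega> \<partial>M)"
    by (auto dest: eventually_happens)
  have "\<forall>\<^sub>F \<gamma> in at_left 0. real n * (a * mean_wait) + K < ((\<integral>\<omega>. exp (\<gamma> * X n \<omega>) \<partial>M) - 1) / \<gamma>"
    by (rule order_tendstoD(1)[OF tendsto_difference_quotient_expectation[OF integrable_log_wealth integrable_exp_log_wealth] n])
  moreover have "\<forall>\<^sub>F \<gamma> in at_left 0. \<gamma> < (0::real)"
    by (simp add: eventually_at_filter)
  ultimately show ?thesis
  proof eventually_elim
    case (elim \<gamma>)
    note elim(1)
    also have "((\<integral>\<omega>. exp (\<gamma> * X n \<omega>) \<partial>M) - 1) / \<gamma> \<le> entropic_utility M \<gamma> (X n)"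
      by (rule entropic_ge_difference_quotient[OF integrable_exp_log_wealth[OF elim(2)] elim(2)])
    also have "\<dots> \<le> real n * (lam \<gamma> * mean_wait) + K"
      by (rule K[OF elim(2) bell[OF elim(2)] \<pi> W])
    finally have "real n * (a * mean_wait) < real n * (lam \<gamma> * mean_wait)" by simp
    then show "a < lam \<gamma>"
      using mean_wait_pos by (simp add: mult_less_cancel_left)
  qed
qed

lemma bellman_constant_tendsto:
  assumes bell: "\<And>\<gamma>. \<gamma> < 0 \<Longrightarrow> bellman_solution M S \<eta> c h \<gamma> (v \<gamma>) (lam \<gamma>)"
    and \<pi>: "\<pi> \<in> weight_simplex"
  shows "((\<lambda>\<gamma>. ereal (lam \<gamma>)) \<longlongrightarrow> (SUP W\<in>strategies M S \<eta> \<G> \<pi>. growth_functional M S \<eta> c h 0 W \<pi>)) (at_left 0)"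
    (is "(_ \<longlongrightarrow> ?J) _")
proof (rule order_tendstoI)
  have le: "ereal (lam \<gamma>) \<le> ?J" if \<gamma>: "\<gamma> < 0" for \<gamma>
    unfolding entropic_value[OF \<gamma> bell[OF \<gamma>] \<pi>, symmetric]
    by (rule SUP_mono) (use growth_functional_mono[OF \<gamma> \<pi>] in blast)
  show "\<forall>\<^sub>F \<gamma> in at_left 0. ereal (lam \<gamma>) < x" if "?J < x" for x
    using le that by (auto simp: eventually_at_filter intro!: always_eventually intro: le_less_trans)
  show "\<forall>\<^sub>F \<gamma> in at_left 0. x < ereal (lam \<gamma>)" if x: "x < ?J" for x
  proof -
    obtain a :: real where a: "x < ereal a" "ereal a < ?J"
      using ereal_dense2[OF x] by auto
    then obtain W where "W \<in> strategies M S \<eta> \<G> \<pi>" "ereal a < growth_functional M S \<eta> c h 0 W \<pi>"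
      by (auto simp: less_SUP_iff)
    from eventually_bellman_constant_greater[OF bell \<pi> this]
    show ?thesis
      by (rule eventually_mono) (use a(1) in \<open>auto intro: less_trans\<close>)
  qed
qed

lemma risk_neutral_value_finite:
  assumes bell: "\<And>\<gamma>. \<gamma> < 0 \<Longrightarrow> bellman_solution M S \<eta> c h \<gamma> (v \<gamma>) (lam \<gamma>)"
    and \<pi>: "\<pi> \<in> weight_simplex"
  shows "\<bar>SUP W\<in>strategies M S \<eta> \<G> \<pi>. growth_functional M S \<eta> c h 0 W \<pi>\<bar> \<noteq> \<infinity>"
    (is "\<bar>?J\<bar> \<noteq> \<infinity>")
proof -
  have "?J \<le> ereal ((\<integral>\<omega>. max_log (R 0 \<omega>) \<partial>M) / mean_wait)"
    by (rule SUP_least) (rule growth_functional_0_le[OF \<pi>])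
  moreover have "ereal (lam (- 1)) \<le> ?J"
    unfolding entropic_value[OF _ bell \<pi>, of "- 1", simplified, symmetric]
    by (rule SUP_mono) (use growth_functional_mono[OF _ \<pi>, of "- 1"] in auto)
  ultimately show ?thesis by auto
qed

end

theorem corollary4p2:
  fixes M :: "'a measure"
    and S :: "real \<Rightarrow> 'a \<Rightarrow> real^'d::finite"
    and \<eta> :: "nat \<Rightarrow> 'a \<Rightarrow> real"
    and \<G> :: "nat \<Rightarrow> 'a measure"
    and c h :: "real^'d"
    and v :: "real \<Rightarrow> real^'d \<Rightarrow> real"
    and lam :: "real \<Rightarrow> real"
  assumes "prob_space M"
    and "cost_rates c h"
    and "price_process M S"
    and "waiting_process M S \<eta>"
    and "increments_cond M S"
    and "waiting_times_cond M \<eta>"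
    and "integrability_cond M S \<eta>"
    and "information M S \<eta> \<G>"
    and "\<And>\<gamma>. \<gamma> < 0 \<Longrightarrow> bellman_solution M S \<eta> c h \<gamma> (v \<gamma>) (lam \<gamma>)"
  shows "\<exists>lam0 :: real. (lam \<longlongrightarrow> lam0) (at_left 0) \<and>
    (\<forall>\<pi>\<in>weight_simplex.
      (SUP W\<in>strategies M S \<eta> \<G> \<pi>. growth_functional M S \<eta> c h 0 W \<pi>) = ereal lam0 \<and>
      ((\<lambda>\<gamma>. SUP W\<in>strategies M S \<eta> \<G> \<pi>. growth_functional M S \<eta> c h \<gamma> W \<pi>)
         \<longlongrightarrow> ereal lam0) (at_left 0))"
proof -
  interpret rebalancing_market M S \<eta> \<G> c h
    by (intro rebalancing_market.intro rebalancing_market_axioms.intro) fact+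
  note bell = assms(9)
  let ?J = "\<lambda>\<gamma> \<pi>. SUP W\<in>strategies M S \<eta> \<G> \<pi>. growth_functional M S \<eta> c h \<gamma> W \<pi>"
  let ?\<pi>0 = "(\<chi> i. 1 / real CARD('d)) :: real^'d"
  obtain lam0 where lam0: "?J 0 ?\<pi>0 = ereal lam0"
    using ereal_real'[OF risk_neutral_value_finite[OF bell uniform_weight]] by metis
  have lim: "((\<lambda>\<gamma>. ereal (lam \<gamma>)) \<longlongrightarrow> ereal lam0) (at_left 0)"
    using bellman_constant_tendsto[OF bell uniform_weight] by (simp only: lam0)
  have "?J 0 \<pi> = ereal lam0" if "\<pi> \<in> weight_simplex" for \<pi>
    by (rule tendsto_unique[OF _ bellman_constant_tendsto[OF bell that] lim])
      (simp add: trivial_limit_at_left_real)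
  moreover have "((\<lambda>\<gamma>. ?J \<gamma> \<pi>) \<longlongrightarrow> ereal lam0) (at_left 0)" if \<pi>: "\<pi> \<in> weight_simplex" for \<pi>
  proof (rule Lim_transform_eventually[OF lim])
    have "\<forall>\<^sub>F \<gamma> in at_left 0. \<gamma> < (0::real)"
      by (simp add: eventually_at_filter)
    then show "\<forall>\<^sub>F \<gamma> in at_left 0. ereal (lam \<gamma>) = ?J \<gamma> \<pi>"
      by eventually_elim (use entropic_value[OF _ bell \<pi>] in simp)
  qed
  moreover have "(lam \<longlongrightarrow> lam0) (at_left 0)"
    using lim by (simp add: lim_ereal)
  ultimately show ?thesis by blast
qed

end
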